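(* Let $\mathsf{C}$ be a strict braided monoidal category and let $(T\colon H\to B,\varphi_{H},\Psi_{H})$ be a weak twisted relative Rota–Baxter operator in $\mathsf{C}$ such that, with $\mathfrak{m}_H:=\varphi_H\circ(T\otimes H)$, $$(\mathfrak{m}_{H}\otimes H)\circ(H\otimes c_{H,H})\circ((c_{H,H}\circ\delta_{H})\otimes H)=(\mathfrak{m}_{H}\otimes H)\circ(H\otimes c_{H,H})\circ(\delta_{H}\otimes H).$$ Then, with $\widetilde{H}=(H,\widetilde{\mu}_{H},\varepsilon_{H},\delta_{H})$ and $\widetilde{\mu}_{H}:=\mu_{H}\circ(\Psi_{H}\otimes\mathfrak{m}_{H})\circ(\delta_{H}\otimes H)$, the triple $\widetilde{\mathbb{H}}=(H,\widetilde{H},\Psi_{H})$ is an object in $\mathsf{HTr}^{\star}$.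
   Context: $\mathsf{C}=(\mathsf{C},\otimes,K,c)$ is a strict braided monoidal category with unit object $K$ and braiding $c_{M,N}\colon M\otimes N\to N\otimes M$. For an object $X$ and a morphism $f$, $X\otimes f$ and $f\otimes X$ denote $\mathrm{id}_X\otimes f$ and $f\otimes \mathrm{id}_X$. A Hopf algebra in $\mathsf{C}$ is $H=(H,\eta_H,\mu_H,\varepsilon_H,\delta_H,\lambda_H)$ (unit, product, counit, coproduct, antipode). The tensor product $D\otimes E$ of coalgebras has coproduct $(D\otimes c_{D,E}\otimes E)\circ(\delta_D\otimes\delta_E)$ and counit $\varepsilon_D\otimes\varepsilon_E$. A non-unital bialgebra $(X,\mu_X,\varepsilon_X,\delta_X)$ is a coalgebra with an associative product $\mu_X$ that is a coalgebra morphism (no unit required). Weak twisted relative Rota–Baxter operator $(T\colon H\to B,\varphi_H,\Psi_H)$: $H$ is a Hopf algebra, $B=(B,\mu_B,\varepsilon_B,\delta_B)$ a non-unital bialgebra, $\varphi_H\colon B\otimes H\to H$ makes $H$ a non-unital left $B$-module algebra-coalgebra, i.e. $\varphi_H\circ(B\otimes\varphi_H)=\varphi_H\circ(\mu_B\otimes H)$, $\varphi_H\circ(B\otimes\eta_H)=\varepsilon_B\otimes\eta_H$, $\varphi_H\circ(B\otimes\mu_H)=\mu_H\circ(\varphi_H\otimes\varphi_H)\circ(B\otimes c_{B,H}\otimes H)\circ(\delta_B\otimes H\otimes H)$, and $\varphi_H$ is a coalgebra morphism; $T\colon H\to B$ and $\Psi_H\colon H\to H$ are coalgebra morphisms such that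 (i) $\mu_{B}\circ(T\otimes T)=T\circ\mu_{H}\circ(\Psi_{H}\otimes(\varphi_H\circ(T\otimes H)))\circ(\delta_{H}\otimes H)$ and (ii) $\Psi_{H}\circ\mu_{H}\circ(\Psi_{H}\otimes(\varphi_H\circ(T\otimes H)))\circ(\delta_{H}\otimes H)=\mu_{H}\circ(\Psi_{H}\otimes(\varphi_H\circ(T\otimes H)))\circ(\delta_{H}\otimes\Psi_{H})$. Hopf truss: $\mathbb{H}=(H_1,H_2,\sigma_H)$ where $(H,\varepsilon_H,\delta_H)$ is a coalgebra, $H_1=(H,\eta_H,\mu_H^1,\varepsilon_H,\delta_H,\lambda_H)$ is a Hopf algebra, $H_2=(H,\mu_H^2,\varepsilon_H,\delta_H)$ is a non-unital bialgebra, and $\sigma_H\colon H\to H$ is a coalgebra morphism such that $\mu_{H}^{2}\circ(H\otimes\mu_{H}^{1})=\mu_{H}^{1}\circ(\mu_{H}^{2}\otimes\Gamma_{H_{1}}^{\sigma_{H}})\circ(H\otimes c_{H,H}\otimes H)\circ(\delta_{H}\otimes H\otimes H)$, where $\Gamma_{H_{1}}^{\sigma_{H}}:=\mu_{H}^{1}\circ((\lambda_{H}\circ\sigma_{H})\otimes\mu_{H}^{2})\circ(\delta_{H}\otimes H)$. $\mathsf{HTr}^{\star}$ is the full subcategory of the category of Hopf trusses on those objects with $(\Gamma_{H_{1}}^{\sigma_{H}}\otimes H)\circ(H\otimes c_{H,H})\circ((c_{H,H}\circ\delta_{H})\otimes H)=(\Gamma_{H_{1}}^{\sigma_{H}}\otimes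 H)\circ(H\otimes c_{H,H})\circ(\delta_{H}\otimes H)$. *)

theory Defs
  imports Main
begin

section \<open>Strict braided monoidal categories\<close>

text \<open>
  A category is given by a set of objects and a set of arrows, each arrow carrying its domain
  and codomain.  As is usual for records with carrier sets, the operations are total functions
  of which only the values at objects and at composable arrows are constrained.
\<close>

record ('o, 'm) braided_cat =
  Ob :: "'o set"
  Ar :: "'m set"
  Dom :: "'m \<Rightarrow> 'o"
  Cod :: "'m \<Rightarrow> 'o"
  Ident :: "'o \<Rightarrow> 'm"  ("\<iota>\<index>")
  Comp :: "'m \<Rightarrow> 'm \<Rightarrow> 'm"  (infixr "\<cdot>\<index>" 55)
  TensorOb :: "'o \<Rightarrow> 'o \<Rightarrow> 'o"  (infixr "\<boxtimes>\<index>" 70)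
  TensorAr :: "'m \<Rightarrow> 'm \<Rightarrow> 'm"  (infixr "\<otimes>\<index>" 70)
  UnitOb :: "'o"  ("\<bbbK>\<index>")
  Braid :: "'o \<Rightarrow> 'o \<Rightarrow> 'm"  ("\<c>\<index>")

definition Hom :: "('o, 'm, 'z) braided_cat_scheme \<Rightarrow> 'o \<Rightarrow> 'o \<Rightarrow> 'm set" where
  "Hom C X Y = {f \<in> Ar C. Dom C f = X \<and> Cod C f = Y}"

locale category =
  fixes C :: "('o, 'm, 'z) braided_cat_scheme" (structure)
  assumes dom_in_Ob: "f \<in> Ar C \<Longrightarrow> Dom C f \<in> Ob C"
    and cod_in_Ob: "f \<in> Ar C \<Longrightarrow> Cod C f \<in> Ob C"
    and ident_in_Hom: "X \<in> Ob C \<Longrightarrow> \<iota> X \<in> Hom C X X"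
    and comp_in_Hom: "\<lbrakk>f \<in> Hom C X Y; g \<in> Hom C Y Z\<rbrakk> \<Longrightarrow> g \<cdot> f \<in> Hom C X Z"
    and ident_comp: "f \<in> Hom C X Y \<Longrightarrow> \<iota> Y \<cdot> f = f"
    and comp_ident: "f \<in> Hom C X Y \<Longrightarrow> f \<cdot> \<iota> X = f"
    and comp_assoc: "\<lbrakk>f \<in> Hom C X Y; g \<in> Hom C Y Z; h \<in> Hom C Z W\<rbrakk>
          \<Longrightarrow> (h \<cdot> g) \<cdot> f = h \<cdot> (g \<cdot> f)"

locale strict_monoidal_category = category +
  assumes unit_in_Ob: "\<bbbK> \<in> Ob C"
    and tensor_in_Ob: "\<lbrakk>X \<in> Ob C; Y \<in> Ob C\<rbrakk> \<Longrightarrow> X \<boxtimes> Y \<in> Ob C"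
    and tensor_in_Hom: "\<lbrakk>f \<in> Hom C X Y; g \<in> Hom C Z W\<rbrakk>
          \<Longrightarrow> f \<otimes> g \<in> Hom C (X \<boxtimes> Z) (Y \<boxtimes> W)"
    and tensor_ident: "\<lbrakk>X \<in> Ob C; Y \<in> Ob C\<rbrakk> \<Longrightarrow> \<iota> X \<otimes> \<iota> Y = \<iota> (X \<boxtimes> Y)"
    and interchange: "\<lbrakk>f \<in> Hom C X Y; g \<in> Hom C Y Z; f' \<in> Hom C X' Y'; g' \<in> Hom C Y' Z'\<rbrakk>
          \<Longrightarrow> (g \<cdot> f) \<otimes> (g' \<cdot> f') = (g \<otimes> g') \<cdot> (f \<otimes> f')"
    and tensor_Ob_assoc: "\<lbrakk>X \<in> Ob C; Y \<in> Ob C; Z \<in> Ob C\<rbrakk>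
          \<Longrightarrow> (X \<boxtimes> Y) \<boxtimes> Z = X \<boxtimes> (Y \<boxtimes> Z)"
    and unit_tensor_Ob: "X \<in> Ob C \<Longrightarrow> \<bbbK> \<boxtimes> X = X"
    and tensor_unit_Ob: "X \<in> Ob C \<Longrightarrow> X \<boxtimes> \<bbbK> = X"
    and tensor_Ar_assoc: "\<lbrakk>f \<in> Ar C; g \<in> Ar C; h \<in> Ar C\<rbrakk>
          \<Longrightarrow> (f \<otimes> g) \<otimes> h = f \<otimes> (g \<otimes> h)"
    and unit_tensor_Ar: "f \<in> Ar C \<Longrightarrow> \<iota> \<bbbK> \<otimes> f = f"
    and tensor_unit_Ar: "f \<in> Ar C \<Longrightarrow> f \<otimes> \<iota> \<bbbK> = f"

locale strict_braided_monoidal_category = strict_monoidal_category +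
  assumes braid_in_Hom: "\<lbrakk>X \<in> Ob C; Y \<in> Ob C\<rbrakk> \<Longrightarrow> \<c> X Y \<in> Hom C (X \<boxtimes> Y) (Y \<boxtimes> X)"
    and braid_iso: "\<lbrakk>X \<in> Ob C; Y \<in> Ob C\<rbrakk>
          \<Longrightarrow> \<exists>d \<in> Hom C (Y \<boxtimes> X) (X \<boxtimes> Y).
                d \<cdot> \<c> X Y = \<iota> (X \<boxtimes> Y) \<and> \<c> X Y \<cdot> d = \<iota> (Y \<boxtimes> X)"
    and braid_natural: "\<lbrakk>f \<in> Hom C X X'; g \<in> Hom C Y Y'\<rbrakk>
          \<Longrightarrow> \<c> X' Y' \<cdot> (f \<otimes> g) = (g \<otimes> f) \<cdot> \<c> X Y"
    and braid_tensor_right: "\<lbrakk>X \<in> Ob C; Y \<in> Ob C; Z \<in> Ob C\<rbrakk>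
          \<Longrightarrow> \<c> X (Y \<boxtimes> Z) = (\<iota> Y \<otimes> \<c> X Z) \<cdot> (\<c> X Y \<otimes> \<iota> Z)"
    and braid_tensor_left: "\<lbrakk>X \<in> Ob C; Y \<in> Ob C; Z \<in> Ob C\<rbrakk>
          \<Longrightarrow> \<c> (X \<boxtimes> Y) Z = (\<c> X Z \<otimes> \<iota> Y) \<cdot> (\<iota> X \<otimes> \<c> Y Z)"


section \<open>Coalgebras, non-unital bialgebras and Hopf algebras\<close>

record ('o, 'm) coalg =
  obj :: "'o"
  counit :: "'m"  ("\<epsilon>\<index>")
  coprod :: "'m"  ("\<delta>\<index>")

record ('o, 'm) nu_bialg = "('o, 'm) coalg" +
  product :: "'m"  ("\<mu>\<index>")

record ('o, 'm) hopf_alg = "('o, 'm) nu_bialg" +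
  unit :: "'m"  ("\<eta>\<index>")
  antipode :: "'m"  ("\<lambda>\<^sub>a\<index>")

context
  fixes C :: "('o, 'm, 'z) braided_cat_scheme" (structure)
begin

definition coalgebra :: "('o, 'm, 'd) coalg_scheme \<Rightarrow> bool" where
  "coalgebra D \<longleftrightarrow>
     obj D \<in> Ob C \<and>
     \<epsilon>\<^bsub>D\<^esub> \<in> Hom C (obj D) \<bbbK> \<and>
     \<delta>\<^bsub>D\<^esub> \<in> Hom C (obj D) (obj D \<boxtimes> obj D) \<and>
     (\<delta>\<^bsub>D\<^esub> \<otimes> \<iota> (obj D)) \<cdot> \<delta>\<^bsub>D\<^esub> = (\<iota> (obj D) \<otimes> \<delta>\<^bsub>D\<^esub>) \<cdot> \<delta>\<^bsub>D\<^esub> \<and>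
     (\<epsilon>\<^bsub>D\<^esub> \<otimes> \<iota> (obj D)) \<cdot> \<delta>\<^bsub>D\<^esub> = \<iota> (obj D) \<and>
     (\<iota> (obj D) \<otimes> \<epsilon>\<^bsub>D\<^esub>) \<cdot> \<delta>\<^bsub>D\<^esub> = \<iota> (obj D)"

definition coalgebra_morphism ::
    "('o, 'm, 'd) coalg_scheme \<Rightarrow> ('o, 'm, 'e) coalg_scheme \<Rightarrow> 'm \<Rightarrow> bool" where
  "coalgebra_morphism D E f \<longleftrightarrow>
     f \<in> Hom C (obj D) (obj E) \<and>
     \<delta>\<^bsub>E\<^esub> \<cdot> f = (f \<otimes> f) \<cdot> \<delta>\<^bsub>D\<^esub> \<and>
     \<epsilon>\<^bsub>E\<^esub> \<cdot> f = \<epsilon>\<^bsub>D\<^esub>"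

definition unit_coalg :: "('o, 'm) coalg" where
  "unit_coalg = \<lparr>obj = \<bbbK>, counit = \<iota> \<bbbK>, coprod = \<iota> \<bbbK>\<rparr>"

definition tensor_coalg ::
    "('o, 'm, 'd) coalg_scheme \<Rightarrow> ('o, 'm, 'e) coalg_scheme \<Rightarrow> ('o, 'm) coalg" where
  "tensor_coalg D E =
     \<lparr>obj = obj D \<boxtimes> obj E,
      counit = \<epsilon>\<^bsub>D\<^esub> \<otimes> \<epsilon>\<^bsub>E\<^esub>,
      coprod = (\<iota> (obj D) \<otimes> \<c> (obj D) (obj E) \<otimes> \<iota> (obj E)) \<cdot> (\<delta>\<^bsub>D\<^esub> \<otimes> \<delta>\<^bsub>E\<^esub>)\<rparr>"

definition nonunital_bialgebra :: "('o, 'm, 'b) nu_bialg_scheme \<Rightarrow> bool" where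
  "nonunital_bialgebra B \<longleftrightarrow>
     coalgebra B \<and>
     coalgebra_morphism (tensor_coalg B B) B \<mu>\<^bsub>B\<^esub> \<and>
     \<mu>\<^bsub>B\<^esub> \<cdot> (\<mu>\<^bsub>B\<^esub> \<otimes> \<iota> (obj B)) = \<mu>\<^bsub>B\<^esub> \<cdot> (\<iota> (obj B) \<otimes> \<mu>\<^bsub>B\<^esub>)"

definition hopf_algebra :: "('o, 'm, 'h) hopf_alg_scheme \<Rightarrow> bool" where
  "hopf_algebra H \<longleftrightarrow>
     nonunital_bialgebra H \<and>
     coalgebra_morphism unit_coalg H \<eta>\<^bsub>H\<^esub> \<and>
     \<mu>\<^bsub>H\<^esub> \<cdot> (\<eta>\<^bsub>H\<^esub> \<otimes> \<iota> (obj H)) = \<iota> (obj H) \<and>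
     \<mu>\<^bsub>H\<^esub> \<cdot> (\<iota> (obj H) \<otimes> \<eta>\<^bsub>H\<^esub>) = \<iota> (obj H) \<and>
     \<lambda>\<^sub>a\<^bsub>H\<^esub> \<in> Hom C (obj H) (obj H) \<and>
     \<mu>\<^bsub>H\<^esub> \<cdot> (\<lambda>\<^sub>a\<^bsub>H\<^esub> \<otimes> \<iota> (obj H)) \<cdot> \<delta>\<^bsub>H\<^esub> = \<eta>\<^bsub>H\<^esub> \<cdot> \<epsilon>\<^bsub>H\<^esub> \<and>
     \<mu>\<^bsub>H\<^esub> \<cdot> (\<iota> (obj H) \<otimes> \<lambda>\<^sub>a\<^bsub>H\<^esub>) \<cdot> \<delta>\<^bsub>H\<^esub> = \<eta>\<^bsub>H\<^esub> \<cdot> \<epsilon>\<^bsub>H\<^esub>"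


section \<open>Weak twisted relative Rota--Baxter operators\<close>

definition nonunital_module_algebra_coalgebra ::
    "('o, 'm, 'b) nu_bialg_scheme \<Rightarrow> ('o, 'm, 'h) hopf_alg_scheme \<Rightarrow> 'm \<Rightarrow> bool" where
  "nonunital_module_algebra_coalgebra B H \<phi> \<longleftrightarrow>
     \<phi> \<cdot> (\<iota> (obj B) \<otimes> \<phi>) = \<phi> \<cdot> (\<mu>\<^bsub>B\<^esub> \<otimes> \<iota> (obj H)) \<and>
     \<phi> \<cdot> (\<iota> (obj B) \<otimes> \<eta>\<^bsub>H\<^esub>) = \<epsilon>\<^bsub>B\<^esub> \<otimes> \<eta>\<^bsub>H\<^esub> \<and>
     \<phi> \<cdot> (\<iota> (obj B) \<otimes> \<mu>\<^bsub>H\<^esub>) =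
       \<mu>\<^bsub>H\<^esub> \<cdot> (\<phi> \<otimes> \<phi>) \<cdot> (\<iota> (obj B) \<otimes> \<c> (obj B) (obj H) \<otimes> \<iota> (obj H))
         \<cdot> (\<delta>\<^bsub>B\<^esub> \<otimes> \<iota> (obj H) \<otimes> \<iota> (obj H)) \<and>
     coalgebra_morphism (tensor_coalg B H) H \<phi>"

definition weak_twisted_relative_rota_baxter ::
    "('o, 'm, 'h) hopf_alg_scheme \<Rightarrow> ('o, 'm, 'b) nu_bialg_scheme \<Rightarrow> 'm \<Rightarrow> 'm \<Rightarrow> 'm \<Rightarrow> bool" where
  "weak_twisted_relative_rota_baxter H B T \<phi> \<Psi> \<longleftrightarrow>
     hopf_algebra H \<and>
     nonunital_bialgebra B \<and>
     nonunital_module_algebra_coalgebra B H \<phi> \<and>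
     coalgebra_morphism H B T \<and>
     coalgebra_morphism H H \<Psi> \<and>
     \<mu>\<^bsub>B\<^esub> \<cdot> (T \<otimes> T) =
       T \<cdot> \<mu>\<^bsub>H\<^esub> \<cdot> (\<Psi> \<otimes> (\<phi> \<cdot> (T \<otimes> \<iota> (obj H)))) \<cdot> (\<delta>\<^bsub>H\<^esub> \<otimes> \<iota> (obj H)) \<and>
     \<Psi> \<cdot> \<mu>\<^bsub>H\<^esub> \<cdot> (\<Psi> \<otimes> (\<phi> \<cdot> (T \<otimes> \<iota> (obj H)))) \<cdot> (\<delta>\<^bsub>H\<^esub> \<otimes> \<iota> (obj H)) =
       \<mu>\<^bsub>H\<^esub> \<cdot> (\<Psi> \<otimes> (\<phi> \<cdot> (T \<otimes> \<iota> (obj H)))) \<cdot> (\<delta>\<^bsub>H\<^esub> \<otimes> \<Psi>)"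


section \<open>Hopf trusses\<close>

definition truss_action ::
    "('o, 'm, 'h) hopf_alg_scheme \<Rightarrow> ('o, 'm, 'b) nu_bialg_scheme \<Rightarrow> 'm \<Rightarrow> 'm"  ("\<Gamma>") where
  "\<Gamma> H1 H2 \<sigma> =
     \<mu>\<^bsub>H1\<^esub> \<cdot> ((\<lambda>\<^sub>a\<^bsub>H1\<^esub> \<cdot> \<sigma>) \<otimes> \<mu>\<^bsub>H2\<^esub>) \<cdot> (\<delta>\<^bsub>H1\<^esub> \<otimes> \<iota> (obj H1))"

definition hopf_truss ::
    "('o, 'm, 'h) hopf_alg_scheme \<Rightarrow> ('o, 'm, 'b) nu_bialg_scheme \<Rightarrow> 'm \<Rightarrow> bool" where
  "hopf_truss H1 H2 \<sigma> \<longleftrightarrow>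
     obj H2 = obj H1 \<and> \<epsilon>\<^bsub>H2\<^esub> = \<epsilon>\<^bsub>H1\<^esub> \<and> \<delta>\<^bsub>H2\<^esub> = \<delta>\<^bsub>H1\<^esub> \<and>
     hopf_algebra H1 \<and>
     nonunital_bialgebra H2 \<and>
     coalgebra_morphism H1 H1 \<sigma> \<and>
     \<mu>\<^bsub>H2\<^esub> \<cdot> (\<iota> (obj H1) \<otimes> \<mu>\<^bsub>H1\<^esub>) =
       \<mu>\<^bsub>H1\<^esub> \<cdot> (\<mu>\<^bsub>H2\<^esub> \<otimes> \<Gamma> H1 H2 \<sigma>)
         \<cdot> (\<iota> (obj H1) \<otimes> \<c> (obj H1) (obj H1) \<otimes> \<iota> (obj H1))
         \<cdot> (\<delta>\<^bsub>H1\<^esub> \<otimes> \<iota> (obj H1) \<otimes> \<iota> (obj H1))"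

text \<open>
  The category \<open>HTr\<^sup>\<star>\<close> is a full subcategory of the category of Hopf trusses, so it is
  determined by its objects; only these are needed here.
\<close>

definition HTr_star_objects :: "(('o, 'm) hopf_alg \<times> ('o, 'm) nu_bialg \<times> 'm) set" where
  "HTr_star_objects =
     {(H1, H2, \<sigma>). hopf_truss H1 H2 \<sigma> \<and>
        (\<Gamma> H1 H2 \<sigma> \<otimes> \<iota> (obj H1)) \<cdot> (\<iota> (obj H1) \<otimes> \<c> (obj H1) (obj H1))
            \<cdot> ((\<c> (obj H1) (obj H1) \<cdot> \<delta>\<^bsub>H1\<^esub>) \<otimes> \<iota> (obj H1)) =
        (\<Gamma> H1 H2 \<sigma> \<otimes> \<iota> (obj H1)) \<cdot> (\<iota> (obj H1) \<otimes> \<c> (obj H1) (obj H1))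
            \<cdot> (\<delta>\<^bsub>H1\<^esub> \<otimes> \<iota> (obj H1))}"

end

end

theory Submission imports Defs begin

text \<open>
  Write \<open>f * g = \<mu> \<circ> (f \<otimes> g) \<circ> \<delta>\<close> for the convolution product of arrows from a coalgebra to
  an algebra. Precomposing the \<open>B\<close>-action with \<open>T\<close> yields a coalgebra morphism
  \<open>\<mm> : H \<otimes> H \<rightarrow> H\<close>, an ``action'' of \<open>H\<close> on itself which distributes over the product of \<open>H\<close>.
  In Sweedler notation (braidings suppressed) the deformed product is
  \<open>\<nu>(a, b) = \<Psi>(a\<^sub>1) \<mm>(a\<^sub>2, b)\<close>, so \<open>\<nu> = (\<Psi> \<otimes> \<epsilon>) * \<mm>\<close> on the coalgebra \<open>H \<otimes> H\<close>. The first
  Rota--Baxter equation and the module law of \<open>\<phi>\<close> give \<open>\<mm>(a, \<mm>(b, x)) = \<mm>(\<nu>(a, b), x)\<close>, and the second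
  one says \<open>\<Psi>(\<nu>(a, b)) = \<nu>(a, \<Psi>(b))\<close>. From there on, \<open>B\<close>, \<open>T\<close> and \<open>\<phi>\<close> are no longer needed.

  The convolution of two coalgebra morphisms into a bialgebra is again a coalgebra morphism
  if the two commute in the sense that \<open>c \<circ> (f \<otimes> g) \<circ> \<delta> = (g \<otimes> f) \<circ> \<delta>\<close>
  (\<open>coalgebra_morphism_convolution\<close>). For \<open>\<Psi> \<otimes> \<epsilon>\<close> and \<open>\<mm>\<close> this follows from the
  cocommutativity-like condition on \<open>\<mm>\<close>, whence \<open>\<nu>\<close> is a coalgebra morphism. Distributivity of \<open>\<mm>\<close>
  and coassociativity yield \<open>\<nu>(a, xy) = \<nu>(a\<^sub>1, x) \<mm>(a\<^sub>2, y)\<close> (\<open>\<nu>_mult\<close>). Hence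
  \<open>\<nu>(a, \<nu>(b, x)) = \<nu>(a\<^sub>1, \<Psi>(b\<^sub>1)) \<mm>(a\<^sub>2, \<mm>(b\<^sub>2, x)) = \<Psi>(\<nu>(a\<^sub>1, b\<^sub>1)) \<mm>(\<nu>(a\<^sub>2, b\<^sub>2), x) = \<nu>(\<nu>(a, b), x)\<close>,
  where the last equality uses that \<open>\<nu>\<close> is a coalgebra morphism. Finally
  \<open>\<lambda>(\<Psi>(a\<^sub>1)) \<nu>(a\<^sub>2, b) = \<mm>(a, b)\<close>, because \<open>\<lambda> \<circ> \<Psi>\<close> is convolution inverse to \<open>\<Psi>\<close>
  (\<open>action_recovered\<close>). So the truss action \<open>\<Gamma>\<close> is \<open>\<mm>\<close>: the truss identity is \<open>\<nu>_mult\<close>, and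
  the condition that defines \<open>HTr\<^sup>\<star>\<close> is the one assumed of \<open>\<mm>\<close>.
\<close>

section \<open>Calculus in strict braided monoidal categories\<close>

context strict_braided_monoidal_category
begin

text \<open>
  Equations between arrows are proved by rewriting. Typing is expressed through \<open>Dom\<close> and \<open>Cod\<close>
  instead of \<open>Hom\<close>, so that the side conditions of conditional rewrite rules contain no variables
  beyond those of the left-hand side and are discharged by the simplifier.
\<close>

lemma HomI: "\<lbrakk>f \<in> Ar C; Dom C f = X; Cod C f = Y\<rbrakk> \<Longrightarrow> f \<in> Hom C X Y"
  by (simp add: Hom_def)

lemma HomD: "f \<in> Hom C X Y \<Longrightarrow> f \<in> Ar C \<and> Dom C f = X \<and> Cod C f = Y"
  by (simp add: Hom_def)

lemma ident_arr: "X \<in> Ob C \<Longrightarrow> \<iota> X \<in> Ar C \<and> Dom C (\<iota> X) = X \<and> Cod C (\<iota> X) = X"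
  using ident_in_Hom by (auto simp: Hom_def)

lemma comp_arr: "\<lbrakk>f \<in> Ar C; g \<in> Ar C; Dom C g = Cod C f\<rbrakk>
    \<Longrightarrow> g \<cdot> f \<in> Ar C \<and> Dom C (g \<cdot> f) = Dom C f \<and> Cod C (g \<cdot> f) = Cod C g"
  using comp_in_Hom[of f "Dom C f" "Cod C f" g "Cod C g"] by (auto simp: Hom_def)

lemma tensor_arr: "\<lbrakk>f \<in> Ar C; g \<in> Ar C\<rbrakk>
    \<Longrightarrow> f \<otimes> g \<in> Ar C \<and> Dom C (f \<otimes> g) = Dom C f \<boxtimes> Dom C g
      \<and> Cod C (f \<otimes> g) = Cod C f \<boxtimes> Cod C g"
  using tensor_in_Hom[of f "Dom C f" "Cod C f" g "Dom C g" "Cod C g"] by (auto simp: Hom_def)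

lemma braid_arr: "\<lbrakk>X \<in> Ob C; Y \<in> Ob C\<rbrakk>
    \<Longrightarrow> \<c> X Y \<in> Ar C \<and> Dom C (\<c> X Y) = X \<boxtimes> Y \<and> Cod C (\<c> X Y) = Y \<boxtimes> X"
  using braid_in_Hom by (auto simp: Hom_def)

lemmas typing =
  ident_arr comp_arr tensor_arr braid_arr dom_in_Ob cod_in_Ob unit_in_Ob tensor_in_Ob
  tensor_Ob_assoc unit_tensor_Ob tensor_unit_Ob

lemma ident_comp': "\<lbrakk>f \<in> Ar C; Cod C f = X\<rbrakk> \<Longrightarrow> \<iota> X \<cdot> f = f"
  by (rule ident_comp) (simp add: Hom_def)

lemma comp_ident': "\<lbrakk>f \<in> Ar C; Dom C f = X\<rbrakk> \<Longrightarrow> f \<cdot> \<iota> X = f"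
  by (rule comp_ident) (simp add: Hom_def)

lemma comp_ident2: "\<lbrakk>f \<in> Ar C; X \<in> Ob C; Y \<in> Ob C; Dom C f = X \<boxtimes> Y\<rbrakk> \<Longrightarrow> f \<cdot> (\<iota> X \<otimes> \<iota> Y) = f"
  by (simp add: tensor_ident comp_ident')

lemma ident_comp2: "\<lbrakk>f \<in> Ar C; X \<in> Ob C; Y \<in> Ob C; Cod C f = X \<boxtimes> Y\<rbrakk> \<Longrightarrow> (\<iota> X \<otimes> \<iota> Y) \<cdot> f = f"
  by (simp add: tensor_ident ident_comp')

lemma comp_assoc': "\<lbrakk>f \<in> Ar C; g \<in> Ar C; h \<in> Ar C; Dom C g = Cod C f; Dom C h = Cod C g\<rbrakk>
    \<Longrightarrow> (h \<cdot> g) \<cdot> f = h \<cdot> g \<cdot> f"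
  by (rule comp_assoc) (simp_all add: Hom_def)

text \<open>
  The interchange law, oriented so that two composable layers of a string diagram are merged
  strand by strand. Since tensor products are kept associated to the right, a block of two strands
  in one layer may face a single arrow in the other, or two strands may face two strands without
  matching one by one; each of these shapes has a rule of its own. The variants with suffix
  \<open>_tail\<close> apply when the two layers are followed by a further arrow \<open>z\<close> in a right-associated
  composite.
\<close>

lemma merge: "\<lbrakk>f \<in> Ar C; f' \<in> Ar C; g \<in> Ar C; g' \<in> Ar C; Dom C g = Cod C f; Dom C g' = Cod C f'\<rbrakk>
    \<Longrightarrow> (g \<otimes> g') \<cdot> (f \<otimes> f') = (g \<cdot> f) \<otimes> (g' \<cdot> f')"
  by (rule interchange[symmetric]) (auto simp: Hom_def)

lemma merge_tail:
  "\<lbrakk>f \<in> Ar C; f' \<in> Ar C; g \<in> Ar C; g' \<in> Ar C; Dom C g = Cod C f; Dom C g' = Cod C f';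
    z \<in> Ar C; Cod C z = Dom C f \<boxtimes> Dom C f'\<rbrakk>
    \<Longrightarrow> (g \<otimes> g') \<cdot> (f \<otimes> f') \<cdot> z = ((g \<cdot> f) \<otimes> (g' \<cdot> f')) \<cdot> z"
  by (simp add: merge[symmetric] comp_assoc' typing)

lemma merge_right2:
  "\<lbrakk>f1 \<in> Ar C; f2 \<in> Ar C; f' \<in> Ar C; g \<in> Ar C; g' \<in> Ar C;
    Dom C g = Cod C f1 \<boxtimes> Cod C f2; Dom C g' = Cod C f'\<rbrakk>
    \<Longrightarrow> (g \<otimes> g') \<cdot> (f1 \<otimes> f2 \<otimes> f') = (g \<cdot> (f1 \<otimes> f2)) \<otimes> (g' \<cdot> f')"
  using merge[of "f1 \<otimes> f2" f' g g'] by (simp add: tensor_Ar_assoc typing)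

lemma merge_left2:
  "\<lbrakk>f \<in> Ar C; f' \<in> Ar C; g1 \<in> Ar C; g2 \<in> Ar C; g' \<in> Ar C;
    Dom C g1 \<boxtimes> Dom C g2 = Cod C f; Dom C g' = Cod C f'\<rbrakk>
    \<Longrightarrow> (g1 \<otimes> g2 \<otimes> g') \<cdot> (f \<otimes> f') = ((g1 \<otimes> g2) \<cdot> f) \<otimes> (g' \<cdot> f')"
  using merge[of f f' "g1 \<otimes> g2" g'] by (simp add: tensor_Ar_assoc typing)

lemma merge_left2_tail:
  "\<lbrakk>f \<in> Ar C; f' \<in> Ar C; g1 \<in> Ar C; g2 \<in> Ar C; g' \<in> Ar C;
    Dom C g1 \<boxtimes> Dom C g2 = Cod C f; Dom C g' = Cod C f'; z \<in> Ar C; Cod C z = Dom C f \<boxtimes> Dom C f'\<rbrakk>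
    \<Longrightarrow> (g1 \<otimes> g2 \<otimes> g') \<cdot> (f \<otimes> f') \<cdot> z = (((g1 \<otimes> g2) \<cdot> f) \<otimes> (g' \<cdot> f')) \<cdot> z"
  using merge_tail[of f f' "g1 \<otimes> g2" g' z] by (simp add: tensor_Ar_assoc typing)

lemma merge22:
  "\<lbrakk>f1 \<in> Ar C; f2 \<in> Ar C; f' \<in> Ar C; g1 \<in> Ar C; g2 \<in> Ar C; g' \<in> Ar C;
    Dom C g1 \<boxtimes> Dom C g2 = Cod C f1 \<boxtimes> Cod C f2; Dom C g' = Cod C f'\<rbrakk>
    \<Longrightarrow> (g1 \<otimes> g2 \<otimes> g') \<cdot> (f1 \<otimes> f2 \<otimes> f') = ((g1 \<otimes> g2) \<cdot> (f1 \<otimes> f2)) \<otimes> (g' \<cdot> f')"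
  using merge[of "f1 \<otimes> f2" f' "g1 \<otimes> g2" g'] by (simp add: tensor_Ar_assoc typing)

text \<open>
  The rules \<open>strict_simps\<close> compute types and remove identities, with identities of tensor products
  split into their factors; the rules \<open>interchange_simps\<close> merge layers. The latter are not confluent:
  which layers get merged depends on the order of rewriting. Longer calculations therefore isolate
  two neighbouring layers, rewrite these, and reassociate with \<open>strict_simps\<close> only.
\<close>

lemmas strict_simps = typing ident_comp' comp_ident' comp_ident2 ident_comp2 comp_assoc'
  tensor_Ar_assoc unit_tensor_Ar tensor_unit_Ar tensor_ident[symmetric]
lemmas interchange_simps = merge merge_tail merge_right2 merge_left2 merge_left2_tail
  merge22

lemma whisker_right: "\<lbrakk>f \<in> Ar C; g \<in> Ar C; Dom C g = Cod C f; X \<in> Ob C\<rbrakk>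
    \<Longrightarrow> (g \<cdot> f) \<otimes> \<iota> X = (g \<otimes> \<iota> X) \<cdot> (f \<otimes> \<iota> X)"
  by (simp add: merge typing comp_ident')

lemma whisker_left: "\<lbrakk>f \<in> Ar C; g \<in> Ar C; Dom C g = Cod C f; X \<in> Ob C\<rbrakk>
    \<Longrightarrow> \<iota> X \<otimes> (g \<cdot> f) = (\<iota> X \<otimes> g) \<cdot> (\<iota> X \<otimes> f)"
  by (simp add: merge typing comp_ident')

text \<open>
  An arrow \<open>e\<close> into the unit object can be slid past any other arrow.
\<close>

lemma tensor_scalar_right:
  "\<lbrakk>f \<in> Ar C; e \<in> Ar C; Cod C e = \<bbbK>\<rbrakk> \<Longrightarrow> f \<otimes> e = f \<cdot> (\<iota> (Dom C f) \<otimes> e)"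
  using merge[of "\<iota> (Dom C f)" e f "\<iota> \<bbbK>"] by (simp add: strict_simps)

lemma tensor_scalar_left:
  "\<lbrakk>f \<in> Ar C; e \<in> Ar C; Cod C e = \<bbbK>\<rbrakk> \<Longrightarrow> e \<otimes> f = f \<cdot> (e \<otimes> \<iota> (Dom C f))"
  using merge[of e "\<iota> (Dom C f)" "\<iota> \<bbbK>" f] by (simp add: strict_simps)

text \<open>
  The hexagon identity makes the braiding with the unit object idempotent; being invertible, it is
  an identity.
\<close>

lemma braid_unit_right:
  assumes X: "X \<in> Ob C"
  shows "\<c> X \<bbbK> = \<iota> X"
proof -
  obtain d where d: "d \<in> Hom C X X" "d \<cdot> \<c> X \<bbbK> = \<iota> X"
    using braid_iso[OF X unit_in_Ob] X by (auto simp: strict_simps)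
  note [simp] = HomD[OF d(1)] X
  have "\<c> X \<bbbK> \<cdot> \<c> X \<bbbK> = \<c> X (\<bbbK> \<boxtimes> \<bbbK>)"
    by (subst braid_tensor_right) (simp_all add: strict_simps)
  then have "\<c> X \<bbbK> \<cdot> \<c> X \<bbbK> = \<c> X \<bbbK>"
    by (simp add: strict_simps)
  moreover have "(d \<cdot> \<c> X \<bbbK>) \<cdot> \<c> X \<bbbK> = d \<cdot> \<c> X \<bbbK> \<cdot> \<c> X \<bbbK>"
    by (rule comp_assoc') (simp_all add: strict_simps)
  ultimately show ?thesis by (simp add: d(2) strict_simps)
qed

lemma braid_unit_left:
  assumes X: "X \<in> Ob C"
  shows "\<c> \<bbbK> X = \<iota> X"
proof -
  obtain d where d: "d \<in> Hom C X X" "\<c> \<bbbK> X \<cdot> d = \<iota> X"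
    using braid_iso[OF unit_in_Ob X] X by (auto simp: strict_simps)
  note [simp] = HomD[OF d(1)] X
  have "\<c> \<bbbK> X \<cdot> \<c> \<bbbK> X = \<c> (\<bbbK> \<boxtimes> \<bbbK>) X"
    by (subst braid_tensor_left) (simp_all add: strict_simps)
  then have "\<c> \<bbbK> X \<cdot> \<c> \<bbbK> X = \<c> \<bbbK> X"
    by (simp add: strict_simps)
  moreover have "\<c> \<bbbK> X \<cdot> (\<c> \<bbbK> X \<cdot> d) = (\<c> \<bbbK> X \<cdot> \<c> \<bbbK> X) \<cdot> d"
    by (rule comp_assoc'[symmetric]) (simp_all add: strict_simps)
  ultimately show ?thesis by (simp add: d(2) strict_simps)
qed

section \<open>Coalgebras and their tensor products\<close>

lemma coalgebraD:
  assumes "coalgebra C D"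
  shows "obj D \<in> Ob C"
    and "\<epsilon>\<^bsub>D\<^esub> \<in> Ar C \<and> Dom C \<epsilon>\<^bsub>D\<^esub> = obj D \<and> Cod C \<epsilon>\<^bsub>D\<^esub> = \<bbbK>"
    and "\<delta>\<^bsub>D\<^esub> \<in> Ar C \<and> Dom C \<delta>\<^bsub>D\<^esub> = obj D \<and> Cod C \<delta>\<^bsub>D\<^esub> = obj D \<boxtimes> obj D"
    and "(\<delta>\<^bsub>D\<^esub> \<otimes> \<iota> (obj D)) \<cdot> \<delta>\<^bsub>D\<^esub> = (\<iota> (obj D) \<otimes> \<delta>\<^bsub>D\<^esub>) \<cdot> \<delta>\<^bsub>D\<^esub>"
    and "(\<epsilon>\<^bsub>D\<^esub> \<otimes> \<iota> (obj D)) \<cdot> \<delta>\<^bsub>D\<^esub> = \<iota> (obj D)"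
    and "(\<iota> (obj D) \<otimes> \<epsilon>\<^bsub>D\<^esub>) \<cdot> \<delta>\<^bsub>D\<^esub> = \<iota> (obj D)"
  using assms by (auto simp: coalgebra_def Hom_def)

lemma coalgebra_morphismD:
  assumes "coalgebra_morphism C D E f"
  shows "f \<in> Ar C \<and> Dom C f = obj D \<and> Cod C f = obj E"
    and "\<delta>\<^bsub>E\<^esub> \<cdot> f = (f \<otimes> f) \<cdot> \<delta>\<^bsub>D\<^esub>"
    and "\<epsilon>\<^bsub>E\<^esub> \<cdot> f = \<epsilon>\<^bsub>D\<^esub>"
  using assms by (auto simp: coalgebra_morphism_def Hom_def)

lemma tensor_coalg_sel [simp]:
  "obj (tensor_coalg C D E) = obj D \<boxtimes> obj E"
  "\<epsilon>\<^bsub>tensor_coalg C D E\<^esub> = \<epsilon>\<^bsub>D\<^esub> \<otimes> \<epsilon>\<^bsub>E\<^esub>"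
  "\<delta>\<^bsub>tensor_coalg C D E\<^esub> =
     (\<iota> (obj D) \<otimes> \<c> (obj D) (obj E) \<otimes> \<iota> (obj E)) \<cdot> (\<delta>\<^bsub>D\<^esub> \<otimes> \<delta>\<^bsub>E\<^esub>)"
  by (simp_all add: tensor_coalg_def)

lemma coalgebra_morphism_comp:
  assumes "coalgebra C D" "coalgebra_morphism C D E f" "coalgebra_morphism C E F g"
    "coalgebra C E" "coalgebra C F"
  shows "coalgebra_morphism C D F (g \<cdot> f)"
proof -
  note [simp] = coalgebraD(1-3)[OF assms(1)] coalgebraD(1-3)[OF assms(4)] coalgebraD(1-3)[OF assms(5)]
    coalgebra_morphismD(1)[OF assms(2)] coalgebra_morphismD(1)[OF assms(3)]
  have "\<delta>\<^bsub>F\<^esub> \<cdot> g \<cdot> f = (\<delta>\<^bsub>F\<^esub> \<cdot> g) \<cdot> f" by (simp add: strict_simps)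
  also have "\<dots> = (g \<otimes> g) \<cdot> \<delta>\<^bsub>E\<^esub> \<cdot> f"
    unfolding coalgebra_morphismD(2)[OF assms(3)] by (simp add: strict_simps)
  also have "\<dots> = ((g \<cdot> f) \<otimes> (g \<cdot> f)) \<cdot> \<delta>\<^bsub>D\<^esub>"
    unfolding coalgebra_morphismD(2)[OF assms(2)] by (simp add: strict_simps interchange_simps)
  finally have coprod: "\<delta>\<^bsub>F\<^esub> \<cdot> g \<cdot> f = ((g \<cdot> f) \<otimes> (g \<cdot> f)) \<cdot> \<delta>\<^bsub>D\<^esub>" .
  have "\<epsilon>\<^bsub>F\<^esub> \<cdot> g \<cdot> f = (\<epsilon>\<^bsub>F\<^esub> \<cdot> g) \<cdot> f" by (simp add: strict_simps)
  also have "\<dots> = \<epsilon>\<^bsub>D\<^esub>" by (simp only: coalgebra_morphismD(3)[OF assms(3)] coalgebra_morphismD(3)[OF assms(2)])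
  finally show ?thesis using coprod by (simp add: coalgebra_morphism_def HomI strict_simps)
qed

text \<open>
  The fourfold coproduct, written so that its two middle factors arise together from one coproduct.
\<close>

lemma coassoc4:
  assumes D: "coalgebra C D"
  shows "(\<delta>\<^bsub>D\<^esub> \<otimes> \<delta>\<^bsub>D\<^esub>) \<cdot> \<delta>\<^bsub>D\<^esub> =
    (\<iota> (obj D) \<otimes> \<delta>\<^bsub>D\<^esub> \<otimes> \<iota> (obj D)) \<cdot> (\<iota> (obj D) \<otimes> \<delta>\<^bsub>D\<^esub>) \<cdot> \<delta>\<^bsub>D\<^esub>"
proof -
  let ?D = "obj D" and ?d = "\<delta>\<^bsub>D\<^esub>"
  note [simp] = coalgebraD(1-3)[OF D]
  note co = coalgebraD(4)[OF D]
  have "(?d \<otimes> ?d) \<cdot> ?d = (?d \<otimes> \<iota> ?D \<otimes> \<iota> ?D) \<cdot> ((\<iota> ?D \<otimes> ?d) \<cdot> ?d)"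
    by (simp add: strict_simps interchange_simps)
  also have "\<dots> = (((?d \<otimes> \<iota> ?D) \<cdot> ?d) \<otimes> \<iota> ?D) \<cdot> ?d"
    by (simp only: co[symmetric]) (simp add: strict_simps interchange_simps)
  also have "(?d \<otimes> \<iota> ?D) \<cdot> ?d = (\<iota> ?D \<otimes> ?d) \<cdot> ?d"
    by (rule co)
  also have "(\<dots> \<otimes> \<iota> ?D) \<cdot> ?d = (\<iota> ?D \<otimes> ?d \<otimes> \<iota> ?D) \<cdot> ((?d \<otimes> \<iota> ?D) \<cdot> ?d)"
    by (simp add: strict_simps interchange_simps)
  finally show ?thesis by (simp only: co)
qed

lemma counit_tensor_counit:
  assumes D: "coalgebra C D"
  shows "(\<epsilon>\<^bsub>D\<^esub> \<otimes> \<epsilon>\<^bsub>D\<^esub>) \<cdot> \<delta>\<^bsub>D\<^esub> = \<epsilon>\<^bsub>D\<^esub>"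
  using coalgebraD(1-3)[OF D]
  by (simp add: tensor_scalar_left[of "\<epsilon>\<^bsub>D\<^esub>" "\<epsilon>\<^bsub>D\<^esub>"] strict_simps coalgebraD(5)[OF D])

lemma coalgebra_morphism_ident: "coalgebra C D \<Longrightarrow> coalgebra_morphism C D D (\<iota> (obj D))"
  by (simp add: coalgebra_morphism_def coalgebraD HomI strict_simps)

lemma counit_braid_right:
  assumes X: "X \<in> Ob C" and E: "coalgebra C E"
  shows "(\<epsilon>\<^bsub>E\<^esub> \<otimes> \<iota> X) \<cdot> \<c> X (obj E) = \<iota> X \<otimes> \<epsilon>\<^bsub>E\<^esub>"
proof -
  note [simp] = X coalgebraD(1-3)[OF E]
  have "(\<epsilon>\<^bsub>E\<^esub> \<otimes> \<iota> X) \<cdot> \<c> X (obj E) = \<c> X \<bbbK> \<cdot> (\<iota> X \<otimes> \<epsilon>\<^bsub>E\<^esub>)"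
    by (rule braid_natural[symmetric]) (simp_all add: HomI strict_simps)
  then show ?thesis by (simp add: braid_unit_right strict_simps)
qed

lemma counit_braid_left:
  assumes X: "X \<in> Ob C" and D: "coalgebra C D"
  shows "(\<iota> X \<otimes> \<epsilon>\<^bsub>D\<^esub>) \<cdot> \<c> (obj D) X = \<epsilon>\<^bsub>D\<^esub> \<otimes> \<iota> X"
proof -
  note [simp] = X coalgebraD(1-3)[OF D]
  have "(\<iota> X \<otimes> \<epsilon>\<^bsub>D\<^esub>) \<cdot> \<c> (obj D) X = \<c> \<bbbK> X \<cdot> (\<epsilon>\<^bsub>D\<^esub> \<otimes> \<iota> X)"
    by (rule braid_natural[symmetric]) (simp_all add: HomI strict_simps)
  then show ?thesis by (simp add: braid_unit_left strict_simps)
qed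

text \<open>
  For coassociativity, naturality in the second factor pushes both coproducts below the crossings and
  leaves \<open>\<c> D (E \<otimes> E)\<close>, which a hexagon identity resolves. Distant crossings commute, so that the
  other hexagon identity can assemble \<open>\<c> (D \<otimes> D) E\<close>; naturality in the first factor finishes. The
  counit laws hold because a counit slides through a crossing.
\<close>

lemma coalgebra_tensor_coalg:
  assumes D: "coalgebra C D" and E: "coalgebra C E"
  shows "coalgebra C (tensor_coalg C D E)"
proof -
  let ?D = "obj D" and ?E = "obj E" and ?d = "\<delta>\<^bsub>D\<^esub>" and ?e = "\<delta>\<^bsub>E\<^esub>" and ?c = "\<c> (obj D) (obj E)"
  let ?\<Delta> = "(\<iota> ?D \<otimes> ?c \<otimes> \<iota> ?E) \<cdot> (?d \<otimes> ?e)"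
  note [simp] = coalgebraD(1-3)[OF D] coalgebraD(1-3)[OF E]
  have natE: "(?e \<otimes> \<iota> ?D) \<cdot> ?c = \<c> ?D (?E \<boxtimes> ?E) \<cdot> (\<iota> ?D \<otimes> ?e)"
    by (rule braid_natural[symmetric]) (simp_all add: HomI strict_simps)
  have natD: "(\<iota> ?E \<otimes> ?d) \<cdot> ?c = \<c> (?D \<boxtimes> ?D) ?E \<cdot> (?d \<otimes> \<iota> ?E)"
    by (rule braid_natural[symmetric]) (simp_all add: HomI strict_simps)
  let ?W = "\<iota> ?D \<otimes> \<iota> ?D \<otimes> ?c \<otimes> \<iota> ?E \<otimes> \<iota> ?E"
  have "(?\<Delta> \<otimes> \<iota> (?D \<boxtimes> ?E)) \<cdot> ?\<Delta> =
      (\<iota> ?D \<otimes> ?c \<otimes> \<iota> ?E \<otimes> \<iota> ?D \<otimes> \<iota> ?E)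
      \<cdot> ((?d \<otimes> ?e \<otimes> \<iota> ?D \<otimes> \<iota> ?E) \<cdot> (\<iota> ?D \<otimes> ?c \<otimes> \<iota> ?E)) \<cdot> (?d \<otimes> ?e)"
    by (subst whisker_right) (simp_all add: strict_simps)
  also have "(?d \<otimes> ?e \<otimes> \<iota> ?D \<otimes> \<iota> ?E) \<cdot> (\<iota> ?D \<otimes> ?c \<otimes> \<iota> ?E) =
      (\<iota> ?D \<otimes> \<iota> ?D \<otimes> \<c> ?D (?E \<boxtimes> ?E) \<otimes> \<iota> ?E) \<cdot> (?d \<otimes> \<iota> ?D \<otimes> ?e \<otimes> \<iota> ?E)"
    by (simp add: strict_simps interchange_simps natE)
  also have "\<iota> ?D \<otimes> \<iota> ?D \<otimes> \<c> ?D (?E \<boxtimes> ?E) \<otimes> \<iota> ?E = (\<iota> ?D \<otimes> \<iota> ?D \<otimes> \<iota> ?E \<otimes> ?c \<otimes> \<iota> ?E) \<cdot> ?W"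
    by (simp add: braid_tensor_right strict_simps interchange_simps)
  also have "(\<iota> ?D \<otimes> ?c \<otimes> \<iota> ?E \<otimes> \<iota> ?D \<otimes> \<iota> ?E) \<cdot> (\<dots> \<cdot> (?d \<otimes> \<iota> ?D \<otimes> ?e \<otimes> \<iota> ?E)) \<cdot> (?d \<otimes> ?e) =
     ((\<iota> ?D \<otimes> ?c \<otimes> \<iota> ?E \<otimes> \<iota> ?D \<otimes> \<iota> ?E) \<cdot> (\<iota> ?D \<otimes> \<iota> ?D \<otimes> \<iota> ?E \<otimes> ?c \<otimes> \<iota> ?E)) \<cdot> ?W \<cdot>
      (((?d \<otimes> \<iota> ?D \<otimes> ?e \<otimes> \<iota> ?E)) \<cdot> (?d \<otimes> ?e))"
    by (simp add: strict_simps)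
  also have "(\<iota> ?D \<otimes> ?c \<otimes> \<iota> ?E \<otimes> \<iota> ?D \<otimes> \<iota> ?E) \<cdot> (\<iota> ?D \<otimes> \<iota> ?D \<otimes> \<iota> ?E \<otimes> ?c \<otimes> \<iota> ?E) =
     (\<iota> ?D \<otimes> \<iota> ?E \<otimes> \<iota> ?D \<otimes> ?c \<otimes> \<iota> ?E) \<cdot> (\<iota> ?D \<otimes> ?c \<otimes> \<iota> ?D \<otimes> \<iota> ?E \<otimes> \<iota> ?E)"
    by (simp add: strict_simps interchange_simps)
  also have "(?d \<otimes> \<iota> ?D \<otimes> ?e \<otimes> \<iota> ?E) \<cdot> (?d \<otimes> ?e) = (\<iota> ?D \<otimes> ?d \<otimes> \<iota> ?E \<otimes> ?e) \<cdot> (?d \<otimes> ?e)"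
    by (simp add: strict_simps interchange_simps coalgebraD(4)[OF D] coalgebraD(4)[OF E])
  also have "((\<iota> ?D \<otimes> \<iota> ?E \<otimes> \<iota> ?D \<otimes> ?c \<otimes> \<iota> ?E) \<cdot> (\<iota> ?D \<otimes> ?c \<otimes> \<iota> ?D \<otimes> \<iota> ?E \<otimes> \<iota> ?E)) \<cdot> ?W \<cdot> \<dots> =
      (\<iota> ?D \<otimes> \<iota> ?E \<otimes> \<iota> ?D \<otimes> ?c \<otimes> \<iota> ?E) \<cdot>
      ((((\<iota> ?D \<otimes> ?c \<otimes> \<iota> ?D \<otimes> \<iota> ?E \<otimes> \<iota> ?E) \<cdot> ?W) \<cdot> (\<iota> ?D \<otimes> ?d \<otimes> \<iota> ?E \<otimes> ?e))) \<cdot> (?d \<otimes> ?e)"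
    by (simp add: strict_simps)
  also have "(\<iota> ?D \<otimes> ?c \<otimes> \<iota> ?D \<otimes> \<iota> ?E \<otimes> \<iota> ?E) \<cdot> ?W = \<iota> ?D \<otimes> \<c> (?D \<boxtimes> ?D) ?E \<otimes> \<iota> ?E \<otimes> \<iota> ?E"
    by (simp add: braid_tensor_left strict_simps interchange_simps)
  also have "\<dots> \<cdot> (\<iota> ?D \<otimes> ?d \<otimes> \<iota> ?E \<otimes> ?e) =
      (\<iota> ?D \<otimes> \<iota> ?E \<otimes> ?d \<otimes> ?e) \<cdot> (\<iota> ?D \<otimes> ?c \<otimes> \<iota> ?E)"
    by (simp add: strict_simps interchange_simps natD)
  also have "(\<iota> ?D \<otimes> \<iota> ?E \<otimes> \<iota> ?D \<otimes> ?c \<otimes> \<iota> ?E) \<cdot> (\<dots>) \<cdot> (?d \<otimes> ?e) = (\<iota> (?D \<boxtimes> ?E) \<otimes> ?\<Delta>) \<cdot> ?\<Delta>"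
    by (subst whisker_left) (simp_all add: strict_simps)
  finally have coassoc: "(?\<Delta> \<otimes> \<iota> (?D \<boxtimes> ?E)) \<cdot> ?\<Delta> = (\<iota> (?D \<boxtimes> ?E) \<otimes> ?\<Delta>) \<cdot> ?\<Delta>" .
  have "((\<epsilon>\<^bsub>D\<^esub> \<otimes> \<epsilon>\<^bsub>E\<^esub>) \<otimes> \<iota> (?D \<boxtimes> ?E)) \<cdot> ?\<Delta> =
      ((\<epsilon>\<^bsub>D\<^esub> \<otimes> \<epsilon>\<^bsub>E\<^esub> \<otimes> \<iota> ?D \<otimes> \<iota> ?E) \<cdot> (\<iota> ?D \<otimes> ?c \<otimes> \<iota> ?E)) \<cdot> (?d \<otimes> ?e)"
    by (simp add: strict_simps)
  also have "(\<epsilon>\<^bsub>D\<^esub> \<otimes> \<epsilon>\<^bsub>E\<^esub> \<otimes> \<iota> ?D \<otimes> \<iota> ?E) \<cdot> (\<iota> ?D \<otimes> ?c \<otimes> \<iota> ?E) = \<epsilon>\<^bsub>D\<^esub> \<otimes> \<iota> ?D \<otimes> \<epsilon>\<^bsub>E\<^esub> \<otimes> \<iota> ?E"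
    by (simp add: strict_simps interchange_simps counit_braid_right[OF _ E])
  also have "\<dots> \<cdot> (?d \<otimes> ?e) = \<iota> (?D \<boxtimes> ?E)"
    by (simp add: strict_simps interchange_simps coalgebraD(5)[OF D] coalgebraD(5)[OF E])
  finally have counit_left: "((\<epsilon>\<^bsub>D\<^esub> \<otimes> \<epsilon>\<^bsub>E\<^esub>) \<otimes> \<iota> (?D \<boxtimes> ?E)) \<cdot> ?\<Delta> = \<iota> (?D \<boxtimes> ?E)" .
  have "(\<iota> (?D \<boxtimes> ?E) \<otimes> (\<epsilon>\<^bsub>D\<^esub> \<otimes> \<epsilon>\<^bsub>E\<^esub>)) \<cdot> ?\<Delta> =
      ((\<iota> ?D \<otimes> \<iota> ?E \<otimes> \<epsilon>\<^bsub>D\<^esub> \<otimes> \<epsilon>\<^bsub>E\<^esub>) \<cdot> (\<iota> ?D \<otimes> ?c \<otimes> \<iota> ?E)) \<cdot> (?d \<otimes> ?e)"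
    by (simp add: strict_simps)
  also have "(\<iota> ?D \<otimes> \<iota> ?E \<otimes> \<epsilon>\<^bsub>D\<^esub> \<otimes> \<epsilon>\<^bsub>E\<^esub>) \<cdot> (\<iota> ?D \<otimes> ?c \<otimes> \<iota> ?E) = \<iota> ?D \<otimes> \<epsilon>\<^bsub>D\<^esub> \<otimes> \<iota> ?E \<otimes> \<epsilon>\<^bsub>E\<^esub>"
    by (simp add: strict_simps interchange_simps counit_braid_left[OF _ D])
  also have "\<dots> \<cdot> (?d \<otimes> ?e) = \<iota> (?D \<boxtimes> ?E)"
    by (simp add: strict_simps interchange_simps coalgebraD(6)[OF D] coalgebraD(6)[OF E])
  finally have counit_right: "(\<iota> (?D \<boxtimes> ?E) \<otimes> (\<epsilon>\<^bsub>D\<^esub> \<otimes> \<epsilon>\<^bsub>E\<^esub>)) \<cdot> ?\<Delta> = \<iota> (?D \<boxtimes> ?E)" .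
  have "\<epsilon>\<^bsub>D\<^esub> \<otimes> \<epsilon>\<^bsub>E\<^esub> \<in> Hom C (?D \<boxtimes> ?E) \<bbbK>"
    "?\<Delta> \<in> Hom C (?D \<boxtimes> ?E) ((?D \<boxtimes> ?E) \<boxtimes> (?D \<boxtimes> ?E))"
    by (simp_all add: HomI strict_simps)
  then show ?thesis
    unfolding coalgebra_def tensor_coalg_sel
    using coassoc counit_left counit_right tensor_in_Ob coalgebraD(1)[OF D] coalgebraD(1)[OF E]
    by (intro conjI)
qed

lemma coalgebra_morphism_tensor:
  assumes D: "coalgebra C D" and D': "coalgebra C D'" and E: "coalgebra C E" and E': "coalgebra C E'"
    and f: "coalgebra_morphism C D D' f" and g: "coalgebra_morphism C E E' g"
  shows "coalgebra_morphism C (tensor_coalg C D E) (tensor_coalg C D' E') (f \<otimes> g)"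
proof -
  let ?D = "obj D" and ?E = "obj E" and ?D' = "obj D'" and ?E' = "obj E'"
  note [simp] = coalgebraD(1-3)[OF D] coalgebraD(1-3)[OF E] coalgebraD(1-3)[OF D'] coalgebraD(1-3)[OF E']
    coalgebra_morphismD(1)[OF f] coalgebra_morphismD(1)[OF g]
  have nat: "\<c> ?D' ?E' \<cdot> (f \<otimes> g) = (g \<otimes> f) \<cdot> \<c> ?D ?E"
    by (rule braid_natural) (simp_all add: HomI)
  have "((\<iota> ?D' \<otimes> \<c> ?D' ?E' \<otimes> \<iota> ?E') \<cdot> (\<delta>\<^bsub>D'\<^esub> \<otimes> \<delta>\<^bsub>E'\<^esub>)) \<cdot> (f \<otimes> g)
      = (\<iota> ?D' \<otimes> \<c> ?D' ?E' \<otimes> \<iota> ?E') \<cdot> ((\<delta>\<^bsub>D'\<^esub> \<cdot> f) \<otimes> (\<delta>\<^bsub>E'\<^esub> \<cdot> g))"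
    by (simp add: strict_simps interchange_simps)
  also have "(\<delta>\<^bsub>D'\<^esub> \<cdot> f) \<otimes> (\<delta>\<^bsub>E'\<^esub> \<cdot> g) = (f \<otimes> f \<otimes> g \<otimes> g) \<cdot> (\<delta>\<^bsub>D\<^esub> \<otimes> \<delta>\<^bsub>E\<^esub>)"
    by (simp add: strict_simps interchange_simps coalgebra_morphismD(2)[OF f] coalgebra_morphismD(2)[OF g])
  also have "(\<iota> ?D' \<otimes> \<c> ?D' ?E' \<otimes> \<iota> ?E') \<cdot> \<dots>
      = ((\<iota> ?D' \<otimes> \<c> ?D' ?E' \<otimes> \<iota> ?E') \<cdot> (f \<otimes> f \<otimes> g \<otimes> g)) \<cdot> (\<delta>\<^bsub>D\<^esub> \<otimes> \<delta>\<^bsub>E\<^esub>)"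
    by (simp add: strict_simps)
  also have "(\<iota> ?D' \<otimes> \<c> ?D' ?E' \<otimes> \<iota> ?E') \<cdot> (f \<otimes> f \<otimes> g \<otimes> g)
      = (f \<otimes> g \<otimes> f \<otimes> g) \<cdot> (\<iota> ?D \<otimes> \<c> ?D ?E \<otimes> \<iota> ?E)"
    by (simp add: strict_simps interchange_simps nat)
  also have "\<dots> \<cdot> (\<delta>\<^bsub>D\<^esub> \<otimes> \<delta>\<^bsub>E\<^esub>)
      = ((f \<otimes> g) \<otimes> (f \<otimes> g)) \<cdot> ((\<iota> ?D \<otimes> \<c> ?D ?E \<otimes> \<iota> ?E) \<cdot> (\<delta>\<^bsub>D\<^esub> \<otimes> \<delta>\<^bsub>E\<^esub>))"
    by (simp add: strict_simps)
  finally show ?thesis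
    by (simp add: coalgebra_morphism_def HomI strict_simps interchange_simps coalgebra_morphismD(3)[OF f]
        coalgebra_morphismD(3)[OF g])
qed

text \<open>
  The arrow \<open>f \<otimes> \<epsilon>\<close> is the projection \<open>D \<otimes> E \<rightarrow> D\<close> followed by \<open>f\<close>.
\<close>

lemma coalgebra_morphism_tensor_counit:
  assumes D: "coalgebra C D" and D': "coalgebra C D'" and E: "coalgebra C E"
    and f: "coalgebra_morphism C D D' f"
  shows "coalgebra_morphism C (tensor_coalg C D E) D' (f \<otimes> \<epsilon>\<^bsub>E\<^esub>)"
proof -
  let ?D = "obj D" and ?E = "obj E" and ?\<pi> = "\<iota> (obj D) \<otimes> \<epsilon>\<^bsub>E\<^esub>"
  note [simp] = coalgebraD(1-3)[OF D] coalgebraD(1-3)[OF E]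
    coalgebra_morphismD(1)[OF f]
  have "(?\<pi> \<otimes> ?\<pi>) \<cdot> ((\<iota> ?D \<otimes> \<c> ?D ?E \<otimes> \<iota> ?E) \<cdot> (\<delta>\<^bsub>D\<^esub> \<otimes> \<delta>\<^bsub>E\<^esub>))
     = ((?\<pi> \<otimes> ?\<pi>) \<cdot> (\<iota> ?D \<otimes> \<c> ?D ?E \<otimes> \<iota> ?E)) \<cdot> (\<delta>\<^bsub>D\<^esub> \<otimes> \<delta>\<^bsub>E\<^esub>)"
    by (simp add: strict_simps)
  also have "(?\<pi> \<otimes> ?\<pi>) \<cdot> (\<iota> ?D \<otimes> \<c> ?D ?E \<otimes> \<iota> ?E) = \<iota> ?D \<otimes> \<iota> ?D \<otimes> \<epsilon>\<^bsub>E\<^esub> \<otimes> \<epsilon>\<^bsub>E\<^esub>"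
    by (simp add: strict_simps interchange_simps counit_braid_right[OF _ E])
  also have "\<dots> \<cdot> (\<delta>\<^bsub>D\<^esub> \<otimes> \<delta>\<^bsub>E\<^esub>) = \<delta>\<^bsub>D\<^esub> \<cdot> ?\<pi>"
    by (simp add: strict_simps interchange_simps counit_tensor_counit[OF E] tensor_scalar_right[of "\<delta>\<^bsub>D\<^esub>"])
  finally have "coalgebra_morphism C (tensor_coalg C D E) D ?\<pi>"
    using tensor_scalar_right[of "\<epsilon>\<^bsub>D\<^esub>" "\<epsilon>\<^bsub>E\<^esub>"] by (simp add: coalgebra_morphism_def HomI strict_simps)
  from coalgebra_morphism_comp[OF coalgebra_tensor_coalg[OF D E] this f D D']
  show ?thesis by (simp add: tensor_scalar_right[of f])
qed

section \<open>Convolution of coalgebra morphisms\<close>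

lemma nonunital_bialgebraD:
  assumes "nonunital_bialgebra C B"
  shows "coalgebra C B"
    and "\<mu>\<^bsub>B\<^esub> \<in> Ar C \<and> Dom C \<mu>\<^bsub>B\<^esub> = obj B \<boxtimes> obj B \<and> Cod C \<mu>\<^bsub>B\<^esub> = obj B"
    and "\<delta>\<^bsub>B\<^esub> \<cdot> \<mu>\<^bsub>B\<^esub> = (\<mu>\<^bsub>B\<^esub> \<otimes> \<mu>\<^bsub>B\<^esub>) \<cdot> (\<iota> (obj B) \<otimes> \<c> (obj B) (obj B) \<otimes> \<iota> (obj B)) \<cdot> (\<delta>\<^bsub>B\<^esub> \<otimes> \<delta>\<^bsub>B\<^esub>)"
    and "\<epsilon>\<^bsub>B\<^esub> \<cdot> \<mu>\<^bsub>B\<^esub> = \<epsilon>\<^bsub>B\<^esub> \<otimes> \<epsilon>\<^bsub>B\<^esub>"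
    and "\<mu>\<^bsub>B\<^esub> \<cdot> (\<mu>\<^bsub>B\<^esub> \<otimes> \<iota> (obj B)) = \<mu>\<^bsub>B\<^esub> \<cdot> (\<iota> (obj B) \<otimes> \<mu>\<^bsub>B\<^esub>)"
  using assms by (auto simp: nonunital_bialgebra_def coalgebra_morphism_def Hom_def)

lemma hopf_algebraD:
  assumes "hopf_algebra C H"
  shows "nonunital_bialgebra C H"
    and "\<eta>\<^bsub>H\<^esub> \<in> Ar C \<and> Dom C \<eta>\<^bsub>H\<^esub> = \<bbbK> \<and> Cod C \<eta>\<^bsub>H\<^esub> = obj H"
    and "\<lambda>\<^sub>a\<^bsub>H\<^esub> \<in> Ar C \<and> Dom C \<lambda>\<^sub>a\<^bsub>H\<^esub> = obj H \<and> Cod C \<lambda>\<^sub>a\<^bsub>H\<^esub> = obj H"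
    and "\<mu>\<^bsub>H\<^esub> \<cdot> (\<eta>\<^bsub>H\<^esub> \<otimes> \<iota> (obj H)) = \<iota> (obj H)"
    and "\<mu>\<^bsub>H\<^esub> \<cdot> (\<lambda>\<^sub>a\<^bsub>H\<^esub> \<otimes> \<iota> (obj H)) \<cdot> \<delta>\<^bsub>H\<^esub> = \<eta>\<^bsub>H\<^esub> \<cdot> \<epsilon>\<^bsub>H\<^esub>"
  using assms by (auto simp: hopf_algebra_def coalgebra_morphism_def unit_coalg_def Hom_def)

text \<open>
  The coproduct of \<open>f * g\<close> is \<open>f(x\<^sub>1) g(x\<^sub>3) \<otimes> f(x\<^sub>2) g(x\<^sub>4)\<close>, with \<open>f(x\<^sub>2)\<close> and \<open>g(x\<^sub>3)\<close>
  crossed. The hypothesis \<open>comm\<close> undoes that crossing.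
\<close>

lemma coalgebra_morphism_convolution:
  assumes D: "coalgebra C D" and A: "nonunital_bialgebra C A"
    and f: "coalgebra_morphism C D A f" and g: "coalgebra_morphism C D A g"
    and comm: "\<c> (obj A) (obj A) \<cdot> (f \<otimes> g) \<cdot> \<delta>\<^bsub>D\<^esub> = (g \<otimes> f) \<cdot> \<delta>\<^bsub>D\<^esub>"
  shows "coalgebra_morphism C D A (\<mu>\<^bsub>A\<^esub> \<cdot> (f \<otimes> g) \<cdot> \<delta>\<^bsub>D\<^esub>)"
proof -
  let ?D = "obj D" and ?A = "obj A" and ?d = "\<delta>\<^bsub>D\<^esub>" and ?\<mu> = "\<mu>\<^bsub>A\<^esub>"
  note [simp] = coalgebraD(1-3)[OF D] coalgebraD(1-3)[OF nonunital_bialgebraD(1)[OF A]]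
    nonunital_bialgebraD(2)[OF A] coalgebra_morphismD(1)[OF f] coalgebra_morphismD(1)[OF g]
  let ?c = "\<iota> ?A \<otimes> \<c> ?A ?A \<otimes> \<iota> ?A"
  have "\<delta>\<^bsub>A\<^esub> \<cdot> ?\<mu> \<cdot> (f \<otimes> g) \<cdot> ?d = (\<delta>\<^bsub>A\<^esub> \<cdot> ?\<mu>) \<cdot> (f \<otimes> g) \<cdot> ?d"
    by (simp add: strict_simps)
  also have "\<dots> = (?\<mu> \<otimes> ?\<mu>) \<cdot> ?c \<cdot> (((\<delta>\<^bsub>A\<^esub> \<otimes> \<delta>\<^bsub>A\<^esub>) \<cdot> (f \<otimes> g)) \<cdot> ?d)"
    by (simp add: nonunital_bialgebraD(3)[OF A] strict_simps)
  also have "((\<delta>\<^bsub>A\<^esub> \<otimes> \<delta>\<^bsub>A\<^esub>) \<cdot> (f \<otimes> g)) \<cdot> ?d = (f \<otimes> f \<otimes> g \<otimes> g) \<cdot> ((?d \<otimes> ?d) \<cdot> ?d)"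
    by (simp add: strict_simps interchange_simps coalgebra_morphismD(2)[OF f] coalgebra_morphismD(2)[OF g])
  also have "(?\<mu> \<otimes> ?\<mu>) \<cdot> ?c \<cdot> \<dots> = (?\<mu> \<otimes> ?\<mu>) \<cdot> (?c \<cdot> (f \<otimes> f \<otimes> g \<otimes> g) \<cdot> (\<iota> ?D \<otimes> ?d \<otimes> \<iota> ?D)) \<cdot> (\<iota> ?D \<otimes> ?d) \<cdot> ?d"
    by (simp add: coassoc4[OF D] strict_simps)
  also have "?c \<cdot> (f \<otimes> f \<otimes> g \<otimes> g) \<cdot> (\<iota> ?D \<otimes> ?d \<otimes> \<iota> ?D) = (f \<otimes> g \<otimes> f \<otimes> g) \<cdot> (\<iota> ?D \<otimes> ?d \<otimes> \<iota> ?D)"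
    by (simp add: strict_simps interchange_simps comm)
  also have "(?\<mu> \<otimes> ?\<mu>) \<cdot> \<dots> \<cdot> (\<iota> ?D \<otimes> ?d) \<cdot> ?d = (?\<mu> \<otimes> ?\<mu>) \<cdot> (f \<otimes> g \<otimes> f \<otimes> g) \<cdot> (?d \<otimes> ?d) \<cdot> ?d"
    by (simp add: coassoc4[OF D] strict_simps)
  also have "\<dots> = ((?\<mu> \<cdot> (f \<otimes> g) \<cdot> ?d) \<otimes> (?\<mu> \<cdot> (f \<otimes> g) \<cdot> ?d)) \<cdot> ?d"
    by (simp add: strict_simps interchange_simps)
  finally have coprod: "\<delta>\<^bsub>A\<^esub> \<cdot> ?\<mu> \<cdot> (f \<otimes> g) \<cdot> ?d = \<dots>" .
  have "\<epsilon>\<^bsub>A\<^esub> \<cdot> ?\<mu> \<cdot> (f \<otimes> g) \<cdot> ?d = (\<epsilon>\<^bsub>A\<^esub> \<cdot> ?\<mu>) \<cdot> (f \<otimes> g) \<cdot> ?d"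
    by (simp add: strict_simps)
  also have "\<dots> = (\<epsilon>\<^bsub>D\<^esub> \<otimes> \<epsilon>\<^bsub>D\<^esub>) \<cdot> ?d"
    by (simp add: nonunital_bialgebraD(4)[OF A] strict_simps interchange_simps
        coalgebra_morphismD(3)[OF f] coalgebra_morphismD(3)[OF g])
  also have "\<dots> = \<epsilon>\<^bsub>D\<^esub>"
    by (rule counit_tensor_counit[OF D])
  finally show ?thesis
    using coprod by (simp add: coalgebra_morphism_def HomI strict_simps)
qed

end

section \<open>Twisted actions of a Hopf algebra on itself\<close>

text \<open>
  What remains of a weak twisted relative Rota--Baxter operator once the action is transported to
  \<open>H\<close>: the twist \<open>\<Psi>\<close>, the arrow \<open>\<mm> : H \<otimes> H \<rightarrow> H\<close>, and the deformed product \<open>\<nu>\<close> that they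
  determine. The product \<open>\<nu>\<close> is a parameter rather than a definition because it occurs in the axioms
  \<open>action_action\<close> and \<open>\<Psi>_\<nu>\<close>. The last axiom is the cocommutativity-like condition on \<open>\<mm>\<close>.
\<close>

locale hopf_twisted_action = strict_braided_monoidal_category C
  for C :: "('o, 'm, 'z) braided_cat_scheme" (structure) +
  fixes H :: "('o, 'm, 'h) hopf_alg_scheme" and \<Psi> \<mm> \<nu> :: 'm
  assumes hopf: "hopf_algebra C H"
    and \<Psi>: "coalgebra_morphism C H H \<Psi>"
    and \<mm>: "coalgebra_morphism C (tensor_coalg C H H) H \<mm>"
    and \<nu>_eq: "\<nu> = \<mu>\<^bsub>H\<^esub> \<cdot> (\<Psi> \<otimes> \<mm>) \<cdot> (\<delta>\<^bsub>H\<^esub> \<otimes> \<iota> (obj H))"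
    and action_mult: "\<mm> \<cdot> (\<iota> (obj H) \<otimes> \<mu>\<^bsub>H\<^esub>) = \<mu>\<^bsub>H\<^esub> \<cdot> (\<mm> \<otimes> \<mm>)
          \<cdot> (\<iota> (obj H) \<otimes> \<c> (obj H) (obj H) \<otimes> \<iota> (obj H)) \<cdot> (\<delta>\<^bsub>H\<^esub> \<otimes> \<iota> (obj H) \<otimes> \<iota> (obj H))"
    and action_action: "\<mm> \<cdot> (\<iota> (obj H) \<otimes> \<mm>) = \<mm> \<cdot> (\<nu> \<otimes> \<iota> (obj H))"
    and \<Psi>_\<nu>: "\<Psi> \<cdot> \<nu> = \<nu> \<cdot> (\<iota> (obj H) \<otimes> \<Psi>)"
    and action_cocommutative: "(\<mm> \<otimes> \<iota> (obj H)) \<cdot> (\<iota> (obj H) \<otimes> \<c> (obj H) (obj H))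
            \<cdot> ((\<c> (obj H) (obj H) \<cdot> \<delta>\<^bsub>H\<^esub>) \<otimes> \<iota> (obj H)) =
         (\<mm> \<otimes> \<iota> (obj H)) \<cdot> (\<iota> (obj H) \<otimes> \<c> (obj H) (obj H)) \<cdot> (\<delta>\<^bsub>H\<^esub> \<otimes> \<iota> (obj H))"
begin

abbreviation A where "A \<equiv> obj H"
abbreviation c where "c \<equiv> \<c> A A"
abbreviation d where "d \<equiv> \<delta>\<^bsub>H\<^esub>"
abbreviation mu where "mu \<equiv> \<mu>\<^bsub>H\<^esub>"

lemmas bialg = hopf_algebraD(1)[OF hopf]
lemmas coalg = nonunital_bialgebraD(1)[OF bialg]
lemmas [simp] = coalgebraD(1-3)[OF coalg] nonunital_bialgebraD(2)[OF bialg] hopf_algebraD(2,3)[OF hopf]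
  coalgebra_morphismD(1)[OF \<Psi>]

lemma \<mm>_arr [simp]: "\<mm> \<in> Ar C \<and> Dom C \<mm> = A \<boxtimes> A \<and> Cod C \<mm> = A"
  using coalgebra_morphismD(1)[OF \<mm>] by simp

lemma \<nu>_arr [simp]: "\<nu> \<in> Ar C \<and> Dom C \<nu> = A \<boxtimes> A \<and> Cod C \<nu> = A"
  by (simp add: \<nu>_eq strict_simps)

lemma mu_assoc: "mu \<cdot> (mu \<otimes> \<iota> A) = mu \<cdot> (\<iota> A \<otimes> mu)"
  by (rule nonunital_bialgebraD(5)[OF bialg])

lemma eps_braid: "(\<epsilon>\<^bsub>H\<^esub> \<otimes> \<iota> A) \<cdot> c = \<iota> A \<otimes> \<epsilon>\<^bsub>H\<^esub>"
  by (rule counit_braid_right) (simp_all add: coalg)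

text \<open>
  The arrows \<open>\<Psi> \<otimes> \<epsilon>\<close> and \<open>\<mm>\<close>, applied in either order to the two halves of the coproduct of
  \<open>H \<otimes> H\<close>. The first order exhibits \<open>\<nu>\<close> as the convolution \<open>(\<Psi> \<otimes> \<epsilon>) * \<mm>\<close>.
\<close>

lemma coprod_twist_action:
  "((\<Psi> \<otimes> \<epsilon>\<^bsub>H\<^esub>) \<otimes> \<mm>) \<cdot> \<delta>\<^bsub>tensor_coalg C H H\<^esub> = (\<Psi> \<otimes> \<mm>) \<cdot> (d \<otimes> \<iota> A)"
proof -
  have "((\<Psi> \<otimes> \<epsilon>\<^bsub>H\<^esub>) \<otimes> \<mm>) \<cdot> \<delta>\<^bsub>tensor_coalg C H H\<^esub>
      = (((\<Psi> \<otimes> \<iota> \<bbbK> \<otimes> \<mm>) \<cdot> (\<iota> A \<otimes> \<epsilon>\<^bsub>H\<^esub> \<otimes> \<iota> A \<otimes> \<iota> A)) \<cdot> (\<iota> A \<otimes> c \<otimes> \<iota> A)) \<cdot> (d \<otimes> d)"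
    using merge[of "\<iota> A" "\<epsilon>\<^bsub>H\<^esub> \<otimes> \<iota> A \<otimes> \<iota> A" \<Psi> "\<iota> \<bbbK> \<otimes> \<mm>"]
    using merge[of "\<epsilon>\<^bsub>H\<^esub>" "\<iota> A \<otimes> \<iota> A" "\<iota> \<bbbK>" "\<mm>"]
    by (simp add: strict_simps)
  also have "\<dots> = (\<Psi> \<otimes> \<mm>) \<cdot> ((\<iota> A \<otimes> \<epsilon>\<^bsub>H\<^esub> \<otimes> \<iota> A \<otimes> \<iota> A) \<cdot> (\<iota> A \<otimes> c \<otimes> \<iota> A)) \<cdot> (d \<otimes> d)"
    by (simp add: strict_simps)
  also have "(\<iota> A \<otimes> \<epsilon>\<^bsub>H\<^esub> \<otimes> \<iota> A \<otimes> \<iota> A) \<cdot> (\<iota> A \<otimes> c \<otimes> \<iota> A) = \<iota> A \<otimes> \<iota> A \<otimes> \<epsilon>\<^bsub>H\<^esub> \<otimes> \<iota> A"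
    by (simp add: strict_simps interchange_simps eps_braid)
  also have "\<dots> \<cdot> (d \<otimes> d) = d \<otimes> \<iota> A"
    by (simp add: strict_simps interchange_simps coalgebraD(5)[OF coalg])
  finally show ?thesis .
qed

lemma coprod_action_twist:
  "(\<mm> \<otimes> (\<Psi> \<otimes> \<epsilon>\<^bsub>H\<^esub>)) \<cdot> \<delta>\<^bsub>tensor_coalg C H H\<^esub> = (\<mm> \<otimes> \<Psi>) \<cdot> (\<iota> A \<otimes> c) \<cdot> (d \<otimes> \<iota> A)"
proof -
  have tens: "(\<iota> A \<otimes> \<iota> A \<otimes> \<iota> A \<otimes> \<epsilon>\<^bsub>H\<^esub>) \<cdot> (d \<otimes> d) = d \<otimes> \<iota> A"
    by (simp add: strict_simps interchange_simps coalgebraD(6)[OF coalg])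
  have "(\<mm> \<otimes> (\<Psi> \<otimes> \<epsilon>\<^bsub>H\<^esub>)) \<cdot> \<delta>\<^bsub>tensor_coalg C H H\<^esub>
      = (\<mm> \<otimes> \<Psi>) \<cdot> ((\<iota> A \<otimes> \<iota> A \<otimes> \<iota> A \<otimes> \<epsilon>\<^bsub>H\<^esub>) \<cdot> (\<iota> A \<otimes> c \<otimes> \<iota> A)) \<cdot> (d \<otimes> d)"
    using tensor_scalar_right[of "\<mm> \<otimes> \<Psi>" "\<epsilon>\<^bsub>H\<^esub>"] by (simp add: strict_simps)
  also have "(\<iota> A \<otimes> \<iota> A \<otimes> \<iota> A \<otimes> \<epsilon>\<^bsub>H\<^esub>) \<cdot> (\<iota> A \<otimes> c \<otimes> \<iota> A) = (\<iota> A \<otimes> c) \<cdot> (\<iota> A \<otimes> \<iota> A \<otimes> \<iota> A \<otimes> \<epsilon>\<^bsub>H\<^esub>)"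
    using tensor_scalar_right[of c "\<epsilon>\<^bsub>H\<^esub>"] by (simp add: strict_simps interchange_simps)
  also have "(\<mm> \<otimes> \<Psi>) \<cdot> \<dots> \<cdot> (d \<otimes> d) = (\<mm> \<otimes> \<Psi>) \<cdot> (\<iota> A \<otimes> c) \<cdot> (d \<otimes> \<iota> A)"
    using comp_assoc'[of "d \<otimes> d" "\<iota> A \<otimes> \<iota> A \<otimes> \<iota> A \<otimes> \<epsilon>\<^bsub>H\<^esub>" "\<iota> A \<otimes> c"] tens
    by (simp add: strict_simps)
  finally show ?thesis .
qed

lemma \<nu>_coalgebra_morphism: "coalgebra_morphism C (tensor_coalg C H H) H \<nu>"
proof -
  have nat: "c \<cdot> (\<Psi> \<otimes> \<mm>) = (\<mm> \<otimes> \<Psi>) \<cdot> \<c> A (A \<boxtimes> A)"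
    by (rule braid_natural) (simp_all add: HomI)
  have "c \<cdot> (\<Psi> \<otimes> \<mm>) \<cdot> (d \<otimes> \<iota> A) = (c \<cdot> (\<Psi> \<otimes> \<mm>)) \<cdot> (d \<otimes> \<iota> A)"
    by (simp add: strict_simps)
  also have "\<dots> = (\<mm> \<otimes> \<Psi>) \<cdot> (\<iota> A \<otimes> c) \<cdot> ((c \<cdot> d) \<otimes> \<iota> A)"
    by (simp add: nat braid_tensor_right strict_simps whisker_right)
  also have "\<mm> \<otimes> \<Psi> = (\<iota> A \<otimes> \<Psi>) \<cdot> (\<mm> \<otimes> \<iota> A)"
    by (simp add: strict_simps interchange_simps)
  \<comment> \<open>The cocommutativity-like condition removes the inner braiding.\<close>
  also have "\<dots> \<cdot> (\<iota> A \<otimes> c) \<cdot> ((c \<cdot> d) \<otimes> \<iota> A) = \<dots> \<cdot> (\<iota> A \<otimes> c) \<cdot> (d \<otimes> \<iota> A)"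
    by (simp add: strict_simps action_cocommutative)
  also have "(\<iota> A \<otimes> \<Psi>) \<cdot> (\<mm> \<otimes> \<iota> A) = \<mm> \<otimes> \<Psi>"
    by (simp add: strict_simps interchange_simps)
  finally have "c \<cdot> (\<Psi> \<otimes> \<mm>) \<cdot> (d \<otimes> \<iota> A) = (\<mm> \<otimes> \<Psi>) \<cdot> (\<iota> A \<otimes> c) \<cdot> (d \<otimes> \<iota> A)" .
  then have comm: "c \<cdot> ((\<Psi> \<otimes> \<epsilon>\<^bsub>H\<^esub>) \<otimes> \<mm>) \<cdot> \<delta>\<^bsub>tensor_coalg C H H\<^esub>
      = (\<mm> \<otimes> (\<Psi> \<otimes> \<epsilon>\<^bsub>H\<^esub>)) \<cdot> \<delta>\<^bsub>tensor_coalg C H H\<^esub>"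
    by (simp only: coprod_twist_action coprod_action_twist)
  show ?thesis
    using coalgebra_morphism_convolution[OF coalgebra_tensor_coalg[OF coalg coalg] bialg
        coalgebra_morphism_tensor_counit[OF coalg coalg coalg \<Psi>] \<mm> comm]
    by (simp only: coprod_twist_action \<nu>_eq)
qed

text \<open>
  In Sweedler notation, \<open>\<nu>(a, xy) = \<Psi>(a\<^sub>1) \<mm>(a\<^sub>2, x) \<mm>(a\<^sub>3, y) = \<nu>(a\<^sub>1, x) \<mm>(a\<^sub>2, y)\<close>.
\<close>

lemma \<nu>_mult: "\<nu> \<cdot> (\<iota> A \<otimes> mu) = mu \<cdot> (\<nu> \<otimes> \<mm>) \<cdot> (\<iota> A \<otimes> c \<otimes> \<iota> A) \<cdot> (d \<otimes> \<iota> A \<otimes> \<iota> A)"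
proof -
  have "\<nu> \<cdot> (\<iota> A \<otimes> mu) = mu \<cdot> (\<Psi> \<otimes> \<mm>) \<cdot> ((d \<otimes> \<iota> A) \<cdot> (\<iota> A \<otimes> mu))"
    by (simp add: \<nu>_eq strict_simps)
  also have "(d \<otimes> \<iota> A) \<cdot> (\<iota> A \<otimes> mu) = (\<iota> A \<otimes> \<iota> A \<otimes> mu) \<cdot> (d \<otimes> \<iota> A \<otimes> \<iota> A)"
    by (simp add: strict_simps interchange_simps)
  also have "mu \<cdot> (\<Psi> \<otimes> \<mm>) \<cdot> \<dots> = mu \<cdot> ((\<Psi> \<otimes> \<mm>) \<cdot> (\<iota> A \<otimes> \<iota> A \<otimes> mu)) \<cdot> (d \<otimes> \<iota> A \<otimes> \<iota> A)"
    by (simp add: strict_simps)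
  also have "(\<Psi> \<otimes> \<mm>) \<cdot> (\<iota> A \<otimes> \<iota> A \<otimes> mu) = \<Psi> \<otimes> (\<mm> \<cdot> (\<iota> A \<otimes> mu))"
    by (simp add: strict_simps interchange_simps)
  also have "\<Psi> \<otimes> (\<mm> \<cdot> (\<iota> A \<otimes> mu)) = (\<iota> A \<otimes> mu) \<cdot> (\<Psi> \<otimes> \<mm> \<otimes> \<mm>)
      \<cdot> (\<iota> A \<otimes> \<iota> A \<otimes> c \<otimes> \<iota> A) \<cdot> (\<iota> A \<otimes> d \<otimes> \<iota> A \<otimes> \<iota> A)"
    by (simp add: action_mult strict_simps interchange_simps)
  also have "mu \<cdot> \<dots> \<cdot> (d \<otimes> \<iota> A \<otimes> \<iota> A) = (mu \<cdot> (\<iota> A \<otimes> mu)) \<cdot> (\<Psi> \<otimes> \<mm> \<otimes> \<mm>)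
      \<cdot> (\<iota> A \<otimes> \<iota> A \<otimes> c \<otimes> \<iota> A) \<cdot> ((\<iota> A \<otimes> d \<otimes> \<iota> A \<otimes> \<iota> A) \<cdot> (d \<otimes> \<iota> A \<otimes> \<iota> A))"
    by (simp add: strict_simps)
  also have "mu \<cdot> (\<iota> A \<otimes> mu) = mu \<cdot> (mu \<otimes> \<iota> A)"
    by (simp only: mu_assoc)
  also have "(\<iota> A \<otimes> d \<otimes> \<iota> A \<otimes> \<iota> A) \<cdot> (d \<otimes> \<iota> A \<otimes> \<iota> A) = (d \<otimes> \<iota> A \<otimes> \<iota> A \<otimes> \<iota> A) \<cdot> (d \<otimes> \<iota> A \<otimes> \<iota> A)"
    by (simp add: coalgebraD(4)[OF coalg] strict_simps interchange_simps)
  also have "(mu \<cdot> (mu \<otimes> \<iota> A)) \<cdot> (\<Psi> \<otimes> \<mm> \<otimes> \<mm>) \<cdot> (\<iota> A \<otimes> \<iota> A \<otimes> c \<otimes> \<iota> A) \<cdot> \<dots>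
      = (mu \<cdot> (mu \<otimes> \<iota> A)) \<cdot> (\<Psi> \<otimes> \<mm> \<otimes> \<mm>)
        \<cdot> ((\<iota> A \<otimes> \<iota> A \<otimes> c \<otimes> \<iota> A) \<cdot> (d \<otimes> \<iota> A \<otimes> \<iota> A \<otimes> \<iota> A)) \<cdot> (d \<otimes> \<iota> A \<otimes> \<iota> A)"
    by (simp add: strict_simps)
  also have "(\<iota> A \<otimes> \<iota> A \<otimes> c \<otimes> \<iota> A) \<cdot> (d \<otimes> \<iota> A \<otimes> \<iota> A \<otimes> \<iota> A)
      = (d \<otimes> \<iota> A \<otimes> \<iota> A \<otimes> \<iota> A) \<cdot> (\<iota> A \<otimes> c \<otimes> \<iota> A)"
    by (simp add: strict_simps interchange_simps)
  also have "(mu \<cdot> (mu \<otimes> \<iota> A)) \<cdot> (\<Psi> \<otimes> \<mm> \<otimes> \<mm>) \<cdot> \<dots> \<cdot> (d \<otimes> \<iota> A \<otimes> \<iota> A)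
      = mu \<cdot> ((mu \<otimes> \<iota> A) \<cdot> (\<Psi> \<otimes> \<mm> \<otimes> \<mm>) \<cdot> (d \<otimes> \<iota> A \<otimes> \<iota> A \<otimes> \<iota> A)) \<cdot> (\<iota> A \<otimes> c \<otimes> \<iota> A) \<cdot> (d \<otimes> \<iota> A \<otimes> \<iota> A)"
    by (simp add: strict_simps)
  also have "(mu \<otimes> \<iota> A) \<cdot> (\<Psi> \<otimes> \<mm> \<otimes> \<mm>) \<cdot> (d \<otimes> \<iota> A \<otimes> \<iota> A \<otimes> \<iota> A) = \<nu> \<otimes> \<mm>"
    by (simp add: \<nu>_eq strict_simps interchange_simps)
  finally show ?thesis .
qed

text \<open>
  Expanding the inner \<open>\<nu>\<close> of \<open>\<nu>(a, \<nu>(b, x))\<close> makes \<open>\<nu>_mult\<close> applicable; the axioms \<open>\<Psi>_\<nu>\<close> and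
  \<open>action_action\<close> then turn both factors into values at \<open>\<nu>(a\<^sub>1, b\<^sub>1)\<close> and \<open>\<nu>(a\<^sub>2, b\<^sub>2)\<close>, which are the
  two halves of the coproduct of \<open>\<nu>(a, b)\<close>.
\<close>

lemma \<nu>_assoc: "\<nu> \<cdot> (\<nu> \<otimes> \<iota> A) = \<nu> \<cdot> (\<iota> A \<otimes> \<nu>)"
proof -
  have nat: "c \<cdot> (\<iota> A \<otimes> \<Psi>) = (\<Psi> \<otimes> \<iota> A) \<cdot> c"
    by (rule braid_natural) (simp_all add: HomI strict_simps)
  have "\<nu> \<cdot> (\<iota> A \<otimes> \<nu>) = (\<nu> \<cdot> (\<iota> A \<otimes> mu)) \<cdot> (\<iota> A \<otimes> ((\<Psi> \<otimes> \<mm>) \<cdot> (d \<otimes> \<iota> A)))"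
    by (subst (2) \<nu>_eq) (simp add: strict_simps interchange_simps)
  also have "\<dots> = mu \<cdot> (\<nu> \<otimes> \<mm>) \<cdot> (\<iota> A \<otimes> c \<otimes> \<iota> A) \<cdot>
      ((d \<otimes> \<iota> A \<otimes> \<iota> A) \<cdot> (\<iota> A \<otimes> ((\<Psi> \<otimes> \<mm>) \<cdot> (d \<otimes> \<iota> A))))"
    by (simp add: \<nu>_mult strict_simps)
  also have "(d \<otimes> \<iota> A \<otimes> \<iota> A) \<cdot> (\<iota> A \<otimes> ((\<Psi> \<otimes> \<mm>) \<cdot> (d \<otimes> \<iota> A)))
      = (\<iota> A \<otimes> \<iota> A \<otimes> \<Psi> \<otimes> \<mm>) \<cdot> (d \<otimes> d \<otimes> \<iota> A)"
    by (simp add: strict_simps interchange_simps)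
  also have "mu \<cdot> (\<nu> \<otimes> \<mm>) \<cdot> (\<iota> A \<otimes> c \<otimes> \<iota> A) \<cdot> \<dots>
      = mu \<cdot> (\<nu> \<otimes> \<mm>) \<cdot> ((\<iota> A \<otimes> c \<otimes> \<iota> A) \<cdot> (\<iota> A \<otimes> \<iota> A \<otimes> \<Psi> \<otimes> \<mm>)) \<cdot> (d \<otimes> d \<otimes> \<iota> A)"
    by (simp add: strict_simps)
  also have "(\<iota> A \<otimes> c \<otimes> \<iota> A) \<cdot> (\<iota> A \<otimes> \<iota> A \<otimes> \<Psi> \<otimes> \<mm>)
      = (\<iota> A \<otimes> \<Psi> \<otimes> \<iota> A \<otimes> \<mm>) \<cdot> (\<iota> A \<otimes> c \<otimes> \<iota> A \<otimes> \<iota> A)"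
    by (simp add: strict_simps interchange_simps nat)
  also have "mu \<cdot> (\<nu> \<otimes> \<mm>) \<cdot> \<dots> \<cdot> (d \<otimes> d \<otimes> \<iota> A)
      = mu \<cdot> ((\<nu> \<otimes> \<mm>) \<cdot> (\<iota> A \<otimes> \<Psi> \<otimes> \<iota> A \<otimes> \<mm>)) \<cdot> (\<iota> A \<otimes> c \<otimes> \<iota> A \<otimes> \<iota> A) \<cdot> (d \<otimes> d \<otimes> \<iota> A)"
    by (simp add: strict_simps)
  also have "(\<nu> \<otimes> \<mm>) \<cdot> (\<iota> A \<otimes> \<Psi> \<otimes> \<iota> A \<otimes> \<mm>) = (\<Psi> \<otimes> \<mm>) \<cdot> (\<nu> \<otimes> \<nu> \<otimes> \<iota> A)"
    by (simp add: strict_simps interchange_simps action_action \<Psi>_\<nu>)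
  also have "mu \<cdot> \<dots> \<cdot> (\<iota> A \<otimes> c \<otimes> \<iota> A \<otimes> \<iota> A) \<cdot> (d \<otimes> d \<otimes> \<iota> A)
     = mu \<cdot> (\<Psi> \<otimes> \<mm>) \<cdot> (((\<nu> \<otimes> \<nu>) \<cdot> \<delta>\<^bsub>tensor_coalg C H H\<^esub>) \<otimes> \<iota> A)"
    by (simp add: strict_simps whisker_right)
  also have "(\<nu> \<otimes> \<nu>) \<cdot> \<delta>\<^bsub>tensor_coalg C H H\<^esub> = d \<cdot> \<nu>"
    by (rule coalgebra_morphismD(2)[OF \<nu>_coalgebra_morphism, symmetric])
  also have "mu \<cdot> (\<Psi> \<otimes> \<mm>) \<cdot> (\<dots> \<otimes> \<iota> A) = \<nu> \<cdot> (\<nu> \<otimes> \<iota> A)"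
    by (subst (2) \<nu>_eq) (simp add: strict_simps whisker_right)
  finally show ?thesis by (rule sym)
qed

text \<open>
  The left-hand side is the truss action \<open>\<Gamma>\<close> that belongs to the product \<open>\<nu>\<close>.
\<close>

lemma action_recovered: "mu \<cdot> ((\<lambda>\<^sub>a\<^bsub>H\<^esub> \<cdot> \<Psi>) \<otimes> \<nu>) \<cdot> (d \<otimes> \<iota> A) = \<mm>"
proof -
  let ?l = "\<lambda>\<^sub>a\<^bsub>H\<^esub>"
  \<comment> \<open>The arrow \<open>\<lambda> \<circ> \<Psi>\<close> is a left convolution inverse of \<open>\<Psi>\<close>, as \<open>\<Psi>\<close> is a coalgebra morphism.\<close>
  have inv: "mu \<cdot> ((?l \<cdot> \<Psi>) \<otimes> \<Psi>) \<cdot> d = \<eta>\<^bsub>H\<^esub> \<cdot> \<epsilon>\<^bsub>H\<^esub>"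
  proof -
    have "mu \<cdot> ((?l \<cdot> \<Psi>) \<otimes> \<Psi>) \<cdot> d = mu \<cdot> (?l \<otimes> \<iota> A) \<cdot> ((\<Psi> \<otimes> \<Psi>) \<cdot> d)"
      by (simp add: strict_simps interchange_simps)
    also have "(\<Psi> \<otimes> \<Psi>) \<cdot> d = d \<cdot> \<Psi>"
      by (rule coalgebra_morphismD(2)[OF \<Psi>, symmetric])
    also have "mu \<cdot> (?l \<otimes> \<iota> A) \<cdot> \<dots> = (mu \<cdot> (?l \<otimes> \<iota> A) \<cdot> d) \<cdot> \<Psi>"
      by (simp add: strict_simps)
    finally show ?thesis
      by (simp add: hopf_algebraD(5)[OF hopf] strict_simps coalgebra_morphismD(3)[OF \<Psi>])
  qed
  have "mu \<cdot> ((?l \<cdot> \<Psi>) \<otimes> \<nu>) \<cdot> (d \<otimes> \<iota> A)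
      = (mu \<cdot> (\<iota> A \<otimes> mu)) \<cdot> ((?l \<cdot> \<Psi>) \<otimes> \<Psi> \<otimes> \<mm>) \<cdot> ((\<iota> A \<otimes> d \<otimes> \<iota> A) \<cdot> (d \<otimes> \<iota> A))"
  proof -
    have "(?l \<cdot> \<Psi>) \<otimes> \<nu> = (\<iota> A \<otimes> mu) \<cdot> ((?l \<cdot> \<Psi>) \<otimes> \<Psi> \<otimes> \<mm>) \<cdot> (\<iota> A \<otimes> d \<otimes> \<iota> A)"
      by (simp add: \<nu>_eq strict_simps interchange_simps)
    then show ?thesis by (simp add: strict_simps)
  qed
  also have "mu \<cdot> (\<iota> A \<otimes> mu) = mu \<cdot> (mu \<otimes> \<iota> A)"
    by (simp only: mu_assoc)
  also have "(\<iota> A \<otimes> d \<otimes> \<iota> A) \<cdot> (d \<otimes> \<iota> A) = (d \<otimes> \<iota> A \<otimes> \<iota> A) \<cdot> (d \<otimes> \<iota> A)"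
    by (simp add: coalgebraD(4)[OF coalg] strict_simps interchange_simps)
  also have "(mu \<cdot> (mu \<otimes> \<iota> A)) \<cdot> ((?l \<cdot> \<Psi>) \<otimes> \<Psi> \<otimes> \<mm>) \<cdot> \<dots>
     = mu \<cdot> ((mu \<otimes> \<iota> A) \<cdot> ((?l \<cdot> \<Psi>) \<otimes> \<Psi> \<otimes> \<mm>) \<cdot> (d \<otimes> \<iota> A \<otimes> \<iota> A)) \<cdot> (d \<otimes> \<iota> A)"
    by (simp add: strict_simps)
  also have "(mu \<otimes> \<iota> A) \<cdot> ((?l \<cdot> \<Psi>) \<otimes> \<Psi> \<otimes> \<mm>) \<cdot> (d \<otimes> \<iota> A \<otimes> \<iota> A) = (\<eta>\<^bsub>H\<^esub> \<cdot> \<epsilon>\<^bsub>H\<^esub>) \<otimes> \<mm>"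
    by (simp add: strict_simps interchange_simps inv)
  also have "\<dots> = (\<eta>\<^bsub>H\<^esub> \<otimes> \<iota> A) \<cdot> \<mm> \<cdot> (\<epsilon>\<^bsub>H\<^esub> \<otimes> \<iota> A \<otimes> \<iota> A)"
    using merge[of "\<epsilon>\<^bsub>H\<^esub>" \<mm> "\<eta>\<^bsub>H\<^esub>" "\<iota> A"] tensor_scalar_left[of \<mm> "\<epsilon>\<^bsub>H\<^esub>"] by (simp add: strict_simps)
  also have "mu \<cdot> \<dots> \<cdot> (d \<otimes> \<iota> A) = (mu \<cdot> (\<eta>\<^bsub>H\<^esub> \<otimes> \<iota> A)) \<cdot> \<mm> \<cdot> ((\<epsilon>\<^bsub>H\<^esub> \<otimes> \<iota> A \<otimes> \<iota> A) \<cdot> (d \<otimes> \<iota> A))"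
    by (simp add: strict_simps)
  also have "mu \<cdot> (\<eta>\<^bsub>H\<^esub> \<otimes> \<iota> A) = \<iota> A"
    by (rule hopf_algebraD(4)[OF hopf])
  also have "(\<epsilon>\<^bsub>H\<^esub> \<otimes> \<iota> A \<otimes> \<iota> A) \<cdot> (d \<otimes> \<iota> A) = \<iota> A \<otimes> \<iota> A"
    by (simp add: strict_simps interchange_simps coalgebraD(5)[OF coalg])
  also have "\<iota> A \<cdot> \<mm> \<cdot> \<dots> = \<mm>"
    by (simp add: strict_simps)
  finally show ?thesis .
qed

end

section \<open>Hopf trusses from weak twisted relative Rota--Baxter operators\<close>

theorem theorem4p8:
  fixes C :: "('o, 'm) braided_cat" (structure)
    and H :: "('o, 'm) hopf_alg" and B :: "('o, 'm) nu_bialg"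
    and T \<phi> \<Psi> \<mm> \<mu>' :: 'm
  assumes "strict_braided_monoidal_category C"
    and "weak_twisted_relative_rota_baxter C H B T \<phi> \<Psi>"
    and "\<mm> = \<phi> \<cdot> (T \<otimes> \<iota> (obj H))"
    and "(\<mm> \<otimes> \<iota> (obj H)) \<cdot> (\<iota> (obj H) \<otimes> \<c> (obj H) (obj H))
            \<cdot> ((\<c> (obj H) (obj H) \<cdot> \<delta>\<^bsub>H\<^esub>) \<otimes> \<iota> (obj H)) =
         (\<mm> \<otimes> \<iota> (obj H)) \<cdot> (\<iota> (obj H) \<otimes> \<c> (obj H) (obj H)) \<cdot> (\<delta>\<^bsub>H\<^esub> \<otimes> \<iota> (obj H))"
    and "\<mu>' = \<mu>\<^bsub>H\<^esub> \<cdot> (\<Psi> \<otimes> \<mm>) \<cdot> (\<delta>\<^bsub>H\<^esub> \<otimes> \<iota> (obj H))"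
  shows "(H, \<lparr>obj = obj H, counit = \<epsilon>\<^bsub>H\<^esub>, coprod = \<delta>\<^bsub>H\<^esub>, product = \<mu>'\<rparr>, \<Psi>)
           \<in> HTr_star_objects C"
proof -
  interpret strict_braided_monoidal_category C by fact
  let ?A = "obj H" and ?B = "obj B"
  have hopf: "hopf_algebra C H" and B: "nonunital_bialgebra C B"
    and T: "coalgebra_morphism C H B T" and \<Psi>: "coalgebra_morphism C H H \<Psi>"
    and \<phi>: "coalgebra_morphism C (tensor_coalg C B H) H \<phi>"
    and act: "\<phi> \<cdot> (\<iota> ?B \<otimes> \<phi>) = \<phi> \<cdot> (\<mu>\<^bsub>B\<^esub> \<otimes> \<iota> ?A)"
    and act_mult: "\<phi> \<cdot> (\<iota> ?B \<otimes> \<mu>\<^bsub>H\<^esub>) = \<mu>\<^bsub>H\<^esub> \<cdot> (\<phi> \<otimes> \<phi>) \<cdot> (\<iota> ?B \<otimes> \<c> ?B ?A \<otimes> \<iota> ?A)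
         \<cdot> (\<delta>\<^bsub>B\<^esub> \<otimes> \<iota> ?A \<otimes> \<iota> ?A)"
    and T_prod: "\<mu>\<^bsub>B\<^esub> \<cdot> (T \<otimes> T) = T \<cdot> \<mu>'"
    and \<Psi>_prod: "\<Psi> \<cdot> \<mu>' = \<mu>\<^bsub>H\<^esub> \<cdot> (\<Psi> \<otimes> \<mm>) \<cdot> (\<delta>\<^bsub>H\<^esub> \<otimes> \<Psi>)"
    using assms(2,3,5)
    by (simp_all only: weak_twisted_relative_rota_baxter_def nonunital_module_algebra_coalgebra_def)
  note bialg = hopf_algebraD(1)[OF hopf]
  note coalgH = nonunital_bialgebraD(1)[OF bialg] and coalgB = nonunital_bialgebraD(1)[OF B]
  note [simp] = coalgebraD(1-3)[OF coalgH] coalgebraD(1-3)[OF coalgB] nonunital_bialgebraD(2)[OF bialg]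
    nonunital_bialgebraD(2)[OF B] coalgebra_morphismD(1)[OF T] coalgebra_morphismD(1)[OF \<Psi>]
    coalgebra_morphismD(1)[OF \<phi>, simplified]
  have \<mm>_arr [simp]: "\<mm> \<in> Ar C \<and> Dom C \<mm> = ?A \<boxtimes> ?A \<and> Cod C \<mm> = ?A"
    by (simp add: assms(3) strict_simps)
  have \<mu>'_arr [simp]: "\<mu>' \<in> Ar C \<and> Dom C \<mu>' = ?A \<boxtimes> ?A \<and> Cod C \<mu>' = ?A"
    by (simp add: assms(5) strict_simps)
  have \<mm>: "coalgebra_morphism C (tensor_coalg C H H) H \<mm>"
    unfolding assms(3)
    by (rule coalgebra_morphism_comp[OF coalgebra_tensor_coalg[OF coalgH coalgH]
          coalgebra_morphism_tensor[OF coalgH coalgB coalgH coalgH T coalgebra_morphism_ident[OF coalgH]]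
          \<phi> coalgebra_tensor_coalg[OF coalgB coalgH] coalgH])
  have action_mult: "\<mm> \<cdot> (\<iota> ?A \<otimes> \<mu>\<^bsub>H\<^esub>) = \<mu>\<^bsub>H\<^esub> \<cdot> (\<mm> \<otimes> \<mm>)
      \<cdot> (\<iota> ?A \<otimes> \<c> ?A ?A \<otimes> \<iota> ?A) \<cdot> (\<delta>\<^bsub>H\<^esub> \<otimes> \<iota> ?A \<otimes> \<iota> ?A)"
  proof -
    have nat: "\<c> ?B ?A \<cdot> (T \<otimes> \<iota> ?A) = (\<iota> ?A \<otimes> T) \<cdot> \<c> ?A ?A"
      by (rule braid_natural) (simp_all add: HomI strict_simps)
    have "\<mm> \<cdot> (\<iota> ?A \<otimes> \<mu>\<^bsub>H\<^esub>) = (\<phi> \<cdot> (\<iota> ?B \<otimes> \<mu>\<^bsub>H\<^esub>)) \<cdot> (T \<otimes> \<iota> ?A \<otimes> \<iota> ?A)"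
      by (simp add: assms(3) strict_simps interchange_simps)
    also have "\<dots> = \<mu>\<^bsub>H\<^esub> \<cdot> (\<phi> \<otimes> \<phi>) \<cdot> (\<iota> ?B \<otimes> \<c> ?B ?A \<otimes> \<iota> ?A) \<cdot>
        ((\<delta>\<^bsub>B\<^esub> \<otimes> \<iota> ?A \<otimes> \<iota> ?A) \<cdot> (T \<otimes> \<iota> ?A \<otimes> \<iota> ?A))"
      by (simp add: act_mult strict_simps)
    also have "(\<delta>\<^bsub>B\<^esub> \<otimes> \<iota> ?A \<otimes> \<iota> ?A) \<cdot> (T \<otimes> \<iota> ?A \<otimes> \<iota> ?A) = (T \<otimes> T \<otimes> \<iota> ?A \<otimes> \<iota> ?A) \<cdot> (\<delta>\<^bsub>H\<^esub> \<otimes> \<iota> ?A \<otimes> \<iota> ?A)"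
      by (simp add: coalgebra_morphismD(2)[OF T] strict_simps interchange_simps)
    also have "\<mu>\<^bsub>H\<^esub> \<cdot> (\<phi> \<otimes> \<phi>) \<cdot> (\<iota> ?B \<otimes> \<c> ?B ?A \<otimes> \<iota> ?A) \<cdot> \<dots>
        = \<mu>\<^bsub>H\<^esub> \<cdot> (\<phi> \<otimes> \<phi>) \<cdot> ((\<iota> ?B \<otimes> \<c> ?B ?A \<otimes> \<iota> ?A) \<cdot> (T \<otimes> T \<otimes> \<iota> ?A \<otimes> \<iota> ?A)) \<cdot> (\<delta>\<^bsub>H\<^esub> \<otimes> \<iota> ?A \<otimes> \<iota> ?A)"
      by (simp add: strict_simps)
    also have "(\<iota> ?B \<otimes> \<c> ?B ?A \<otimes> \<iota> ?A) \<cdot> (T \<otimes> T \<otimes> \<iota> ?A \<otimes> \<iota> ?A)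
        = (T \<otimes> \<iota> ?A \<otimes> T \<otimes> \<iota> ?A) \<cdot> (\<iota> ?A \<otimes> \<c> ?A ?A \<otimes> \<iota> ?A)"
      by (simp add: strict_simps interchange_simps nat)
    also have "\<mu>\<^bsub>H\<^esub> \<cdot> (\<phi> \<otimes> \<phi>) \<cdot> \<dots> \<cdot> (\<delta>\<^bsub>H\<^esub> \<otimes> \<iota> ?A \<otimes> \<iota> ?A)
        = \<mu>\<^bsub>H\<^esub> \<cdot> ((\<phi> \<otimes> \<phi>) \<cdot> (T \<otimes> \<iota> ?A \<otimes> T \<otimes> \<iota> ?A)) \<cdot> (\<iota> ?A \<otimes> \<c> ?A ?A \<otimes> \<iota> ?A) \<cdot> (\<delta>\<^bsub>H\<^esub> \<otimes> \<iota> ?A \<otimes> \<iota> ?A)"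
      by (simp add: strict_simps)
    also have "(\<phi> \<otimes> \<phi>) \<cdot> (T \<otimes> \<iota> ?A \<otimes> T \<otimes> \<iota> ?A) = \<mm> \<otimes> \<mm>"
      by (simp add: assms(3) strict_simps interchange_simps)
    finally show ?thesis .
  qed
  have action_action: "\<mm> \<cdot> (\<iota> ?A \<otimes> \<mm>) = \<mm> \<cdot> (\<mu>' \<otimes> \<iota> ?A)"
  proof -
    have "\<mm> \<cdot> (\<iota> ?A \<otimes> \<mm>) = (\<phi> \<cdot> (\<iota> ?B \<otimes> \<phi>)) \<cdot> (T \<otimes> T \<otimes> \<iota> ?A)"
      by (simp add: assms(3) strict_simps interchange_simps)
    also have "\<dots> = \<phi> \<cdot> ((\<mu>\<^bsub>B\<^esub> \<cdot> (T \<otimes> T)) \<otimes> \<iota> ?A)"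
      by (simp add: act strict_simps interchange_simps)
    also have "\<dots> = \<mm> \<cdot> (\<mu>' \<otimes> \<iota> ?A)"
      by (simp only: T_prod) (simp add: assms(3) strict_simps interchange_simps)
    finally show ?thesis .
  qed
  have \<Psi>_\<nu>: "\<Psi> \<cdot> \<mu>' = \<mu>' \<cdot> (\<iota> ?A \<otimes> \<Psi>)"
    by (simp only: \<Psi>_prod) (simp add: assms(5) strict_simps interchange_simps)
  interpret hopf_twisted_action C H \<Psi> \<mm> \<mu>'
    by unfold_locales (fact hopf \<Psi> \<mm> assms action_mult action_action \<Psi>_\<nu>)+
  let ?H' = "\<lparr>obj = obj H, counit = \<epsilon>\<^bsub>H\<^esub>, coprod = \<delta>\<^bsub>H\<^esub>, product = \<mu>'\<rparr>"
  have action: "truss_action C H ?H' \<Psi> = \<mm>"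
    by (simp add: truss_action_def action_recovered)
  have "nonunital_bialgebra C ?H'"
    using coalgH \<nu>_coalgebra_morphism \<nu>_assoc
    by (simp add: nonunital_bialgebra_def coalgebra_def coalgebra_morphism_def tensor_coalg_def)
  then have "hopf_truss C H ?H' \<Psi>"
    using hopf \<Psi> \<nu>_mult by (simp add: hopf_truss_def action)
  then show ?thesis
    using assms(4) by (simp add: HTr_star_objects_def action)
qed

end
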